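(* Let $\kappa\ge\Delta\ge 2$. Let $F_t$ be the rooted forest after $t$ updates of a fixed (oblivious) update sequence in the rooted-forest model, starting from the empty forest, and let $C_t$ be the random coloring maintained by rooted {\textsc{DistMaint}}. Then for every $t\ge 0$, $C_t$ is distributed exactly as $\mathcal D(F_t)$.
   Context: Rooted-forest model: each tree on a fixed vertex set has an assigned root (initially no edges, every vertex a root); an insertion $(p,r)$ requires $r$ to be a root and makes $r$ a child of $p$; deleting $(p,r)$, $p$ the parent of $r$, makes $r$ a root. Maximum degree stays at most $\Delta$. Palette $[\kappa]$; $A(x)$ = colors not used on edges at $x$. Distribution: a uniform coloring from a set $S\subseteq[\kappa]$ of the $\ell$ child edges of $v$ is a uniformly random injective map from the children of $v$ to $S$. For a rooted tree $T$ with root $r$ and color $\alpha$, $\mathcal D_\alpha(T)$: uniformly color the child edges of $r$ from $[\kappa]\setminus\{\alpha\}$, then independently for each child $u$ sample the coloring of the subtree $T_u$ (of $u$ and its descendants) from $\mathcal D_{\mathrm{color}(r,u)}(T_u)$. $\mathcal D(T)$ is the same except the root's child edges are uniformly colored from $[\kappa]$. $\mathcal D(F)$ samples each tree of $F$ independently from $\mathcal D(T)$. Rooted {\textsc{DistMaint}}: FixForbidden$(v,\alpha,\beta)$: if no child edge of $v$ has color $\beta$ stop; else recolor that child edge $(v,w)$ to $\alpha$ and call FixForbidden$(w,\beta,\alpha)$. Insertion $(p,r)$: choose $\beta$ uniformly from $A(p)$, color $(p,r)$ by $\beta$; if no child edge of $r$ has color $\beta$ stop, else for that edge $(r,w)$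 choose $\alpha$ uniformly from $A(r)$, recolor $(r,w)$ to $\alpha$ and call FixForbidden$(w,\beta,\alpha)$. Deletion of $(p,r)$ with color $\alpha$: delete it; with $\ell$ the number of children of $r$, with probability $(\kappa-\ell)/\kappa$ stop; otherwise pick a uniformly random child $w$, let $\beta=\mathrm{color}(r,w)$, recolor $(r,w)$ to $\alpha$ and call FixForbidden$(w,\beta,\alpha)$. Random choices independent. *)

theory Defs
  imports "HOL-Probability.Probability" "HOL-Probability.Product_PMF"
begin

text \<open>
  The vertex set is a finite type \<open>'v\<close>. A rooted forest is given by its parent map; the roots are
  the vertices mapped to \<open>None\<close>. As every edge is determined by its lower endpoint, an edge coloring
  is a partial map on vertices: \<open>C r = Some a\<close> says that the edge from \<open>r\<close> to its parent has color
  \<open>a\<close>, and \<open>C r = None\<close> says that \<open>r\<close> has no parent edge. The palette is \<open>{1..\<kappa>}\<close>.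
\<close>

type_synonym 'v forest = "'v \<Rightarrow> 'v option"
type_synonym 'v coloring = "'v \<rightharpoonup> nat"

definition edges :: "'v forest \<Rightarrow> ('v \<times> 'v) set" where
  "edges F = {(p, r). F r = Some p}"

definition is_forest :: "'v forest \<Rightarrow> bool" where
  "is_forest F \<longleftrightarrow> acyclic (edges F)"

definition children :: "'v forest \<Rightarrow> 'v \<Rightarrow> 'v set" where
  "children F v = {u. F u = Some v}"

definition roots :: "'v forest \<Rightarrow> 'v set" where
  "roots F = {r. F r = None}"

definition degree :: "'v forest \<Rightarrow> 'v \<Rightarrow> nat" where
  "degree F v = card (children F v) + (if F v = None then 0 else 1)"

definition avail :: "nat \<Rightarrow> 'v forest \<Rightarrow> 'v coloring \<Rightarrow> 'v \<Rightarrow> nat set" where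
  "avail \<kappa> F C x = {1..\<kappa>} - {a. C x = Some a \<or> (\<exists>y\<in>children F x. C y = Some a)}"


datatype 'v update = Insert 'v 'v | Delete 'v 'v

fun apply_update :: "'v update \<Rightarrow> 'v forest \<Rightarrow> 'v forest" where
  "apply_update (Insert p r) F = F(r := Some p)"
| "apply_update (Delete p r) F = F(r := None)"

text \<open>
  The requirement that the result of an insertion be a forest says that \<open>p\<close> lies in a tree other
  than the one rooted at \<open>r\<close>.
\<close>

fun legal :: "nat \<Rightarrow> 'v forest \<Rightarrow> 'v update \<Rightarrow> bool" where
  "legal \<Delta> F (Insert p r) \<longleftrightarrow>
     F r = None \<and> is_forest (F(r := Some p)) \<and> (\<forall>v. degree (F(r := Some p)) v \<le> \<Delta>)"
| "legal \<Delta> F (Delete p r) \<longleftrightarrow> F r = Some p"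

primrec forest_at :: "(nat \<Rightarrow> 'v update) \<Rightarrow> nat \<Rightarrow> 'v forest" where
  "forest_at us 0 = (\<lambda>_. None)"
| "forest_at us (Suc t) = apply_update (us t) (forest_at us t)"


definition uniform_coloring :: "'v forest \<Rightarrow> nat set \<Rightarrow> 'v \<Rightarrow> 'v coloring pmf" where
  "uniform_coloring F S v =
     pmf_of_set {f. dom f = children F v \<and> ran f \<subseteq> S \<and> inj_on f (dom f)}"

text \<open>Union of the colorings \<open>m u\<close>, \<open>u \<in> U\<close>; it is used for colorings with pairwise disjoint domains.\<close>

definition glue :: "'v set \<Rightarrow> ('v \<Rightarrow> 'v coloring) \<Rightarrow> 'v coloring" where
  "glue U m = (\<lambda>x. if \<exists>u\<in>U. x \<in> dom (m u) then m (THE u. u \<in> U \<and> x \<in> dom (m u)) x else None)"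

lemma card_descendants_less:
  fixes F :: "'v::finite forest"
  assumes "is_forest F" "u \<in> children F v"
  shows "card {x. (u, x) \<in> (edges F)\<^sup>*} < card {x. (v, x) \<in> (edges F)\<^sup>*}"
proof (rule psubset_card_mono)
  have e: "(v, u) \<in> edges F"
    using assms(2) by (simp add: children_def edges_def)
  have "(u, v) \<notin> (edges F)\<^sup>*"
    using assms(1) e unfolding is_forest_def acyclic_def by (meson rtrancl_into_trancl2)
  then show "{x. (u, x) \<in> (edges F)\<^sup>*} \<subset> {x. (v, x) \<in> (edges F)\<^sup>*}"
    using e by (auto intro: converse_rtrancl_into_rtrancl)
qed simp

declare Pi_pmf_cong [fundef_cong]

text \<open>
  Coloring of the subtree of \<open>v\<close> and its descendants in which the child edges of \<open>v\<close> are uniformly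
  colored from \<open>S\<close>: the distribution \<open>\<D>\<^sub>\<alpha>\<close> is the case \<open>S = {1..\<kappa>} - {\<alpha>}\<close>, and \<open>\<D>\<close> of a tree is
  the case \<open>S = {1..\<kappa>}\<close>. The guard \<open>is_forest F\<close> only serves to make the recursion total.
\<close>

function dist_below :: "nat \<Rightarrow> 'v::finite forest \<Rightarrow> nat set \<Rightarrow> 'v \<Rightarrow> 'v coloring pmf" where
  "dist_below \<kappa> F S v =
     (if is_forest F then
        do {
          f \<leftarrow> uniform_coloring F S v;
          m \<leftarrow> Pi_pmf (children F v) Map.empty (\<lambda>u. dist_below \<kappa> F ({1..\<kappa>} - {the (f u)}) u);
          return_pmf (f ++ glue (children F v) m)
        }
      else return_pmf Map.empty)"
  by auto
termination
  by (relation "Wellfounded.measure (\<lambda>(\<kappa>, F, S, v). card {x. (v, x) \<in> (edges F)\<^sup>*})")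
     (auto intro: card_descendants_less)

declare dist_below.simps [simp del]

definition dist_avoid :: "nat \<Rightarrow> 'v::finite forest \<Rightarrow> nat \<Rightarrow> 'v \<Rightarrow> 'v coloring pmf" where
  "dist_avoid \<kappa> F \<alpha> v = dist_below \<kappa> F ({1..\<kappa>} - {\<alpha>}) v"

definition dist_tree :: "nat \<Rightarrow> 'v::finite forest \<Rightarrow> 'v \<Rightarrow> 'v coloring pmf" where
  "dist_tree \<kappa> F r = dist_below \<kappa> F {1..\<kappa>} r"

lemma dist_avoid_rec:
  assumes "is_forest F"
  shows "dist_avoid \<kappa> F \<alpha> v =
    do {
      f \<leftarrow> uniform_coloring F ({1..\<kappa>} - {\<alpha>}) v;
      m \<leftarrow> Pi_pmf (children F v) Map.empty (\<lambda>u. dist_avoid \<kappa> F (the (f u)) u);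
      return_pmf (f ++ glue (children F v) m)
    }"
  using assms unfolding dist_avoid_def by (subst dist_below.simps) simp

lemma dist_tree_rec:
  assumes "is_forest F"
  shows "dist_tree \<kappa> F r =
    do {
      f \<leftarrow> uniform_coloring F {1..\<kappa>} r;
      m \<leftarrow> Pi_pmf (children F r) Map.empty (\<lambda>u. dist_avoid \<kappa> F (the (f u)) u);
      return_pmf (f ++ glue (children F r) m)
    }"
  using assms unfolding dist_avoid_def dist_tree_def by (subst dist_below.simps) simp

definition dist_forest :: "nat \<Rightarrow> 'v::finite forest \<Rightarrow> 'v coloring pmf" where
  "dist_forest \<kappa> F = map_pmf (glue (roots F)) (Pi_pmf (roots F) Map.empty (dist_tree \<kappa> F))"


text \<open>
  In a proper coloring the vertex chosen by \<open>THE\<close> is unique, and on a forest the recursion walks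
  down the tree and ends.
\<close>

partial_function (tailrec) fix_forbidden ::
    "'v forest \<Rightarrow> 'v \<Rightarrow> nat \<Rightarrow> nat \<Rightarrow> 'v coloring \<Rightarrow> 'v coloring" where
  "fix_forbidden F v \<alpha> \<beta> C =
     (if \<exists>w\<in>children F v. C w = Some \<beta> then
        let w = (THE w. w \<in> children F v \<and> C w = Some \<beta>)
        in fix_forbidden F w \<beta> \<alpha> (C(w \<mapsto> \<alpha>))
      else C)"

definition insert_step ::
    "nat \<Rightarrow> 'v forest \<Rightarrow> 'v \<Rightarrow> 'v \<Rightarrow> 'v coloring \<Rightarrow> 'v coloring pmf" where
  "insert_step \<kappa> F p r C =
     do {
       \<beta> \<leftarrow> pmf_of_set (avail \<kappa> F C p);
       let F' = F(r := Some p);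
       let C' = C(r \<mapsto> \<beta>);
       if \<exists>w\<in>children F' r. C' w = Some \<beta> then
         do {
           let w = (THE w. w \<in> children F' r \<and> C' w = Some \<beta>);
           \<alpha> \<leftarrow> pmf_of_set (avail \<kappa> F' C' r);
           return_pmf (fix_forbidden F' w \<beta> \<alpha> (C'(w \<mapsto> \<alpha>)))
         }
       else return_pmf C'
     }"

definition delete_step ::
    "nat \<Rightarrow> 'v forest \<Rightarrow> 'v \<Rightarrow> 'v coloring \<Rightarrow> 'v coloring pmf" where
  "delete_step \<kappa> F r C =
     do {
       let \<alpha> = the (C r);
       let F' = F(r := None);
       let C' = C(r := None);
       let l = card (children F' r);
       stop \<leftarrow> bernoulli_pmf ((real \<kappa> - real l) / real \<kappa>);
       if stop then return_pmf C'
       else do {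
         w \<leftarrow> pmf_of_set (children F' r);
         let \<beta> = the (C' w);
         return_pmf (fix_forbidden F' w \<beta> \<alpha> (C'(w \<mapsto> \<alpha>)))
       }
     }"

fun dist_maint_step ::
    "nat \<Rightarrow> 'v forest \<Rightarrow> 'v update \<Rightarrow> 'v coloring \<Rightarrow> 'v coloring pmf" where
  "dist_maint_step \<kappa> F (Insert p r) C = insert_step \<kappa> F p r C"
| "dist_maint_step \<kappa> F (Delete p r) C = delete_step \<kappa> F r C"

primrec coloring_at :: "nat \<Rightarrow> (nat \<Rightarrow> 'v update) \<Rightarrow> nat \<Rightarrow> 'v coloring pmf" where
  "coloring_at \<kappa> us 0 = return_pmf Map.empty"
| "coloring_at \<kappa> us (Suc t) =
     do {
       C \<leftarrow> coloring_at \<kappa> us t;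
       dist_maint_step \<kappa> (forest_at us t) (us t) C
     }"

end

theory Submission
  imports Defs
begin

text \<open>
  Up to renaming colors, the number of ways to color the subtree below \<open>u\<close> does not depend on the
  color of the edge above \<open>u\<close>. Hence \<open>\<D>(F)\<close> is the uniform distribution on the proper colorings of
  \<open>F\<close>, and it remains to see that an update maps the uniform distribution on the proper colorings of
  the old forest to that of the new one. FixForbidden exchanges two colors along an alternating path
  that goes down from its starting vertex. The exchange does not change the path and is therefore an
  involution, which makes deleting an edge the time reversal of inserting it: for proper colorings
  \<open>C\<close> of the forest without the edge and \<open>D\<close> of the forest with it, the transition probabilities
  from \<open>C\<close> to \<open>D\<close> and from \<open>D\<close> to \<open>C\<close> have a constant ratio. Two such kernels map the uniform
  distributions to each other, since the rows of either one sum to 1.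
\<close>

subsection \<open>The distribution of the forest is uniform\<close>

text \<open>The stopping probability of a deletion is what makes the ratio constant. Let l be the
  number of children of \<open>r\<close>. An insertion without conflict has probability 1/|A(p)| and
  is undone by a deletion that stops, with probability (\<kappa> - l)/\<kappa>. An insertion that
  recolors a child edge has probability 1/(|A(p)| |A(r)|) and is undone by a deletion that picks the
  same child, with probability (l/\<kappa>)(1/l) = 1/\<kappa>. As |A(r)| = \<kappa> - l, the ratio
  is \<kappa>/(|A(p)| |A(r)|) in both cases, and these sizes depend only on the forest. The
  orientation enters through the path: it starts at a child of \<open>r\<close> and goes down, so it
  touches neither the edges at \<open>p\<close> nor the other child edges of \<open>r\<close>, and
  both kinds of update see the same path. One obstacle is that FixForbidden passes through improper
  colorings; it is therefore compared with a single exchange along a path computed from the coloring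
  before the run.\<close>

definition below :: "'v forest \<Rightarrow> 'v \<Rightarrow> 'v set" where
  "below F v = {x. (v, x) \<in> (edges F)\<^sup>+}"

text \<open>Edges are named by their lower endpoints, so \<open>F x = F y\<close> describes siblings and \<open>A\<close> must not
  contain roots, which would otherwise count as siblings of each other.\<close>

definition proper_on :: "'v forest \<Rightarrow> 'v set \<Rightarrow> 'v coloring \<Rightarrow> bool" where
  "proper_on F A C \<longleftrightarrow>
     (\<forall>x\<in>A. \<forall>y\<in>A. F x = F y \<or> F x = Some y \<longrightarrow> C x = C y \<longrightarrow> x = y)"

text \<open>\<open>below F v\<close> leaves out \<open>v\<close>, so it consists of exactly the
  edges of the subtree, named by their lower endpoints. The edge above \<open>v\<close> acts only
  through \<open>S\<close>; as \<open>S\<close> binds only the child edges of \<open>v\<close>, the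
  palette is imposed on the deeper edges separately.\<close>

definition subtree_colorings :: "nat \<Rightarrow> 'v forest \<Rightarrow> nat set \<Rightarrow> 'v \<Rightarrow> 'v coloring set" where
  "subtree_colorings \<kappa> F S v =
     {C. dom C = below F v \<and> ran C \<subseteq> {1..\<kappa>} \<and> proper_on F (below F v) C \<and>
         C ` children F v \<subseteq> Some ` S}"

definition proper_colorings :: "nat \<Rightarrow> 'v forest \<Rightarrow> 'v coloring set" where
  "proper_colorings \<kappa> F = {C. dom C = dom F \<and> ran C \<subseteq> {1..\<kappa>} \<and> proper_on F (dom F) C}"

section \<open>Descendants and properness in a rooted forest\<close>

lemma edges_iff [simp]: "(u, x) \<in> edges F \<longleftrightarrow> F x = Some u"
  by (simp add: edges_def)

lemma children_iff [simp]: "x \<in> children F v \<longleftrightarrow> F x = Some v"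
  by (simp add: children_def)

lemma in_roots_iff [simp]: "r \<in> roots F \<longleftrightarrow> F r = None"
  by (simp add: roots_def)

lemma proper_onD:
  "proper_on F A C \<Longrightarrow> x \<in> A \<Longrightarrow> y \<in> A \<Longrightarrow> F x = F y \<or> F x = Some y \<Longrightarrow> C x = C y \<Longrightarrow> x = y"
  unfolding proper_on_def by blast

lemma proper_on_cong:
  "(\<And>x. x \<in> A \<Longrightarrow> C x = C' x) \<Longrightarrow> proper_on F A C \<longleftrightarrow> proper_on F A C'"
  unfolding proper_on_def by auto

lemma proper_on_subset: "proper_on F A C \<Longrightarrow> B \<subseteq> A \<Longrightarrow> proper_on F B C"
  unfolding proper_on_def by blast

lemma in_below_iff: "x \<in> below F v \<longleftrightarrow> (\<exists>u. F x = Some u \<and> (v, u) \<in> (edges F)\<^sup>*)"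
  unfolding below_def by (auto dest: tranclD2 intro: rtrancl_into_trancl1)

lemma below_child: "x \<in> below F v \<Longrightarrow> F y = Some x \<Longrightarrow> y \<in> below F v"
  unfolding below_def by (auto intro: trancl_into_trancl)

lemma below_sibling: "x \<in> below F v \<Longrightarrow> F x = F y \<Longrightarrow> y \<in> below F v"
  by (auto simp: in_below_iff)

lemma below_base: "F x = Some v \<Longrightarrow> x \<in> below F v"
  by (auto simp: in_below_iff)

lemma below_trans: "x \<in> below F u \<Longrightarrow> u \<in> below F v \<Longrightarrow> x \<in> below F v"
  unfolding below_def by auto

lemma below_unfold: "below F v = children F v \<union> (\<Union>u\<in>children F v. below F u)"
proof (intro equalityI subsetI)
  fix x assume "x \<in> below F v"
  then show "x \<in> children F v \<union> (\<Union>u\<in>children F v. below F u)"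
    unfolding below_def by (auto dest!: tranclD simp: rtrancl_eq_or_trancl)
next
  fix x assume "x \<in> children F v \<union> (\<Union>u\<in>children F v. below F u)"
  then show "x \<in> below F v" by (auto intro: below_base below_trans[OF _ below_base])
qed

lemma below_irrefl: "is_forest F \<Longrightarrow> v \<notin> below F v"
  by (simp add: is_forest_def acyclic_def below_def)

lemma below_subset_dom: "below F v \<subseteq> dom F"
  by (auto simp: in_below_iff)

text \<open>The parent map is single-valued, so the ancestors of \<open>x\<close> form a chain and
  distinct \<open>u\<close>, \<open>u'\<close> would be comparable. If \<open>u\<close> is below
  \<open>u'\<close>, then so is its sibling \<open>u'\<close> itself, against acyclicity. The
  hypothesis \<open>F u = F u'\<close> covers siblings and pairs of roots alike.\<close>

lemma below_disjoint:
  assumes "is_forest F" "F u = F u'" "x \<in> below F u" "x \<in> below F u'"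
  shows "u = u'"
proof -
  have "single_valued ((edges F)\<inverse>)" by (auto simp: single_valued_def)
  moreover have "(x, u) \<in> ((edges F)\<inverse>)\<^sup>*" "(x, u') \<in> ((edges F)\<inverse>)\<^sup>*"
    using assms(3,4) by (auto simp: below_def rtrancl_converse)
  ultimately have "(u, u') \<in> ((edges F)\<inverse>)\<^sup>* \<or> (u', u) \<in> ((edges F)\<inverse>)\<^sup>*"
    by (rule single_valued_confluent)
  then have "u = u' \<or> u \<in> below F u' \<or> u' \<in> below F u"
    by (auto simp: below_def rtrancl_converse rtrancl_eq_or_trancl)
  then show ?thesis
    using below_sibling[of u F u' u'] below_sibling[of u' F u u] below_irrefl[OF assms(1)] assms(2)
    by metis
qed

lemma forest_induct:
  fixes F :: "'v::finite forest"
  assumes "is_forest F" and step: "\<And>v. (\<And>u. F u = Some v \<Longrightarrow> P u) \<Longrightarrow> P v"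
  shows "P v"
proof -
  have "wf ((edges F)\<inverse>)"
    using assms(1) by (intro finite_acyclic_wf_converse) (auto simp: is_forest_def)
  then show ?thesis
    by (induction v rule: wf_induct_rule) (auto intro: step)
qed

lemma dom_eq_UN_below_roots:
  fixes F :: "'v::finite forest"
  assumes "is_forest F"
  shows "dom F = (\<Union>r\<in>roots F. below F r)"
proof -
  have wf: "wf (edges F)"
    using assms by (intro finite_acyclic_wf) (auto simp: is_forest_def)
  have "\<exists>r. F r = None \<and> (r, x) \<in> (edges F)\<^sup>*" for x
    using wf
  proof (induction x rule: wf_induct_rule)
    case (less x)
    then show ?case
      by (cases "F x") (auto, meson edges_iff rtrancl.rtrancl_into_rtrancl)
  qed
  then show ?thesis
    by (fastforce simp: in_below_iff)
qed

text \<open>The hypothesis on \<open>U\<close> fits both the children of a vertex and the set of all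
  roots, the two places where independent samples are combined. Siblings and children of an edge
  below \<open>u\<close> are again below \<open>u\<close>, so no two adjacent edges lie in different
  sets \<open>below F u\<close>, and restriction to these sets inverts the gluing.\<close>

lemma bij_betw_glue:
  fixes F :: "'v::finite forest"
  assumes "is_forest F" and U: "\<And>u u'. u \<in> U \<Longrightarrow> u' \<in> U \<Longrightarrow> F u = F u'"
  shows "bij_betw (glue U)
     (PiE_dflt U Map.empty (\<lambda>u. subtree_colorings \<kappa> F (S u) u))
     {C. dom C = (\<Union>u\<in>U. below F u) \<and> ran C \<subseteq> {1..\<kappa>} \<and> proper_on F (\<Union>u\<in>U. below F u) C \<and>
         (\<forall>u\<in>U. C ` children F u \<subseteq> Some ` S u)}" (is "bij_betw _ ?M ?C")
proof -
  have disj: "u = u'" if "u \<in> U" "u' \<in> U" "x \<in> below F u" "x \<in> below F u'" for u u' x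
    using below_disjoint[OF assms(1) U] that by blast
  have M: "dom (m u) = below F u" if "m \<in> ?M" "u \<in> U" for m u
    using that by (auto simp: PiE_dflt_def subtree_colorings_def)
  have glue_in: "glue U m x = m u x" if "m \<in> ?M" "u \<in> U" "x \<in> below F u" for m u x
  proof -
    have "\<exists>u\<in>U. x \<in> dom (m u)" using that M by auto
    moreover have "(THE u. u \<in> U \<and> x \<in> dom (m u)) = u"
      by (rule the_equality) (use that M[OF that(1)] disj in blast)+
    ultimately show ?thesis unfolding glue_def by simp
  qed
  have glue_out: "glue U m x = None" if "m \<in> ?M" "x \<notin> (\<Union>u\<in>U. below F u)" for m x
    using that M unfolding glue_def by auto
  show ?thesis
  \<comment> \<open>Outside \<open>U\<close> the witness takes the default value of
    \<open>PiE_dflt\<close>, so that it returns the family \<open>m\<close> exactly.\<close>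
  proof (rule bij_betw_byWitness[where f' = "\<lambda>C u. if u \<in> U then C |` below F u else Map.empty"])
    show "\<forall>m\<in>?M. (\<lambda>u. if u \<in> U then glue U m |` below F u else Map.empty) = m"
    proof
      fix m assume m: "m \<in> ?M"
      have "(if u \<in> U then glue U m |` below F u else Map.empty) x = m u x" for u x
      proof (cases "u \<in> U \<and> x \<in> below F u")
        case True
        then show ?thesis using glue_in[OF m] by simp
      next
        case False
        then have "m u x = None" using m M[OF m, of u] by (cases "u \<in> U") (auto simp: PiE_dflt_def)
        then show ?thesis using False by auto
      qed
      then show "(\<lambda>u. if u \<in> U then glue U m |` below F u else Map.empty) = m" by blast
    qed
    have W: "(\<lambda>u. if u \<in> U then C |` below F u else Map.empty) \<in> ?M" if "C \<in> ?C" for C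
    proof -
      have "C |` below F u \<in> subtree_colorings \<kappa> F (S u) u" if u: "u \<in> U" for u
      proof -
        have "dom (C |` below F u) = below F u" using \<open>C \<in> ?C\<close> u by auto
        moreover have "ran (C |` below F u) \<subseteq> {1..\<kappa>}"
          using \<open>C \<in> ?C\<close> ran_restrictD[of _ C "below F u"] by (auto simp: ran_def restrict_map_def)
        moreover have "proper_on F (below F u) (C |` below F u)"
          using \<open>C \<in> ?C\<close> u by (subst proper_on_cong[of _ _ C]) (auto intro: proper_on_subset)
        moreover have "(C |` below F u) ` children F u \<subseteq> Some ` S u"
          using \<open>C \<in> ?C\<close> u by (auto simp: below_base)
        ultimately show ?thesis by (simp add: subtree_colorings_def)
      qed
      then show ?thesis by (auto simp: PiE_dflt_def)
    qed
    then show "(\<lambda>C u. if u \<in> U then C |` below F u else Map.empty) ` ?C \<subseteq> ?M" by blast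
    show "\<forall>C\<in>?C. glue U (\<lambda>u. if u \<in> U then C |` below F u else Map.empty) = C"
    proof
      fix C assume C: "C \<in> ?C"
      have "glue U (\<lambda>u. if u \<in> U then C |` below F u else Map.empty) x = C x" for x
      proof (cases "x \<in> (\<Union>u\<in>U. below F u)")
        case True
        then show ?thesis using glue_in[OF W[OF C]] by auto
      next
        case False
        then have "x \<notin> dom C" using C by blast
        then show ?thesis using glue_out[OF W[OF C] False] by (simp add: domIff)
      qed
      then show "glue U (\<lambda>u. if u \<in> U then C |` below F u else Map.empty) = C" by blast
    qed
    show "glue U ` ?M \<subseteq> ?C"
    proof
      fix C assume "C \<in> glue U ` ?M"
      then obtain m where m: "m \<in> ?M" and C: "C = glue U m" by blast
      have mu: "m u \<in> subtree_colorings \<kappa> F (S u) u" if "u \<in> U" for u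
        using m that by (auto simp: PiE_dflt_def)
      have inC: "C x = m u x" if "u \<in> U" "x \<in> below F u" for u x
        using glue_in[OF m] C that by simp
      have "dom C = (\<Union>u\<in>U. below F u)"
      proof (intro equalityI subsetI)
        fix x assume "x \<in> dom C"
        then show "x \<in> (\<Union>u\<in>U. below F u)" using glue_out[OF m] C by force
      next
        fix x assume "x \<in> (\<Union>u\<in>U. below F u)"
        then show "x \<in> dom C" using inC M[OF m] by force
      qed
      moreover have "ran C \<subseteq> {1..\<kappa>}"
      proof
        fix a assume "a \<in> ran C"
        then obtain x where x: "C x = Some a" by (auto simp: ran_def)
        then obtain u where "u \<in> U" "x \<in> below F u" using calculation by blast
        then have "a \<in> ran (m u)" using inC x by (metis ranI)
        then show "a \<in> {1..\<kappa>}" using mu[OF \<open>u \<in> U\<close>] by (auto simp: subtree_colorings_def)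
      qed
      moreover have "proper_on F (\<Union>u\<in>U. below F u) C"
        unfolding proper_on_def
      proof (intro ballI impI)
        fix x y
        assume x: "x \<in> (\<Union>u\<in>U. below F u)" and y: "y \<in> (\<Union>u\<in>U. below F u)"
          and adj: "F x = F y \<or> F x = Some y" and eq: "C x = C y"
        from y obtain u where u: "u \<in> U" "y \<in> below F u" by blast
        then have x: "x \<in> below F u" using adj below_sibling[of y F u x] below_child[of y F u x] by metis
        have "proper_on F (below F u) (m u)" using mu[OF u(1)] by (simp add: subtree_colorings_def)
        then show "x = y"
          by (rule proper_onD) (use u x adj eq inC in auto)
      qed
      moreover have "C ` children F u \<subseteq> Some ` S u" if "u \<in> U" for u
        using mu[OF that] inC[OF that] by (auto simp: subtree_colorings_def below_base image_subset_iff)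
      ultimately show "C \<in> ?C" by simp
    qed
  qed
qed

section \<open>Uniform laws on the colorings of subtrees\<close>

lemma finite_subtree_colorings:
  fixes F :: "'v::finite forest"
  shows "finite (subtree_colorings \<kappa> F S v)"
  by (rule finite_subset[OF _ finite_set_of_finite_maps[of "below F v" "{1..\<kappa>}"]])
     (auto simp: subtree_colorings_def)

lemma finite_proper_colorings:
  fixes F :: "'v::finite forest"
  shows "finite (proper_colorings \<kappa> F)"
  by (rule finite_subset[OF _ finite_set_of_finite_maps[of "dom F" "{1..\<kappa>}"]])
     (auto simp: proper_colorings_def)

lemma PiE_dflt_nonempty:
  assumes "\<And>u. u \<in> U \<Longrightarrow> B u \<noteq> {}"
  shows "PiE_dflt U d B \<noteq> {}"
proof -
  have "(\<lambda>u. if u \<in> U then SOME b. b \<in> B u else d) \<in> PiE_dflt U d B"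
    using assms by (auto simp: PiE_dflt_def some_in_eq)
  then show ?thesis by blast
qed

text \<open>A product of uniform laws is uniform on the product set, and a bijection carries it to a
  uniform law.\<close>

lemma map_pmf_glue_uniform:
  fixes F :: "'v::finite forest"
  assumes "is_forest F" and "\<And>u u'. u \<in> U \<Longrightarrow> u' \<in> U \<Longrightarrow> F u = F u'"
    and ne: "\<And>u. u \<in> U \<Longrightarrow> subtree_colorings \<kappa> F (S u) u \<noteq> {}"
  shows "map_pmf (glue U)
       (Pi_pmf U Map.empty (\<lambda>u. pmf_of_set (subtree_colorings \<kappa> F (S u) u))) =
     pmf_of_set
      {C. dom C = (\<Union>u\<in>U. below F u) \<and> ran C \<subseteq> {1..\<kappa>} \<and> proper_on F (\<Union>u\<in>U. below F u) C \<and>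
          (\<forall>u\<in>U. C ` children F u \<subseteq> Some ` S u)}"
proof -
  let ?M = "PiE_dflt U Map.empty (\<lambda>u. subtree_colorings \<kappa> F (S u) u)"
  have "?M \<noteq> {}" by (rule PiE_dflt_nonempty) (rule ne)
  moreover have "finite ?M" by (intro finite_PiE_dflt finite_subtree_colorings) simp
  moreover have "Pi_pmf U Map.empty (\<lambda>u. pmf_of_set (subtree_colorings \<kappa> F (S u) u)) = pmf_of_set ?M"
    by (rule Pi_pmf_of_set) (use ne finite_subtree_colorings in auto)
  ultimately show ?thesis
    using map_pmf_of_set_bij_betw[OF bij_betw_glue[OF assms(1,2)]] by simp
qed

text \<open>Exchanging the names \<open>a\<close> and \<open>b\<close> in the whole subtree is
  injective on colors, so it keeps properness, and it turns the forbidden color \<open>a\<close> of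
  the child edges into \<open>b\<close>.\<close>

lemma recolor_subtree_colorings:
  assumes "a \<in> {1..\<kappa>}" "b \<in> {1..\<kappa>}" "C \<in> subtree_colorings \<kappa> F ({1..\<kappa>} - {a}) v"
  shows "map_option (Transposition.transpose a b) \<circ> C \<in> subtree_colorings \<kappa> F ({1..\<kappa>} - {b}) v"
proof -
  let ?t = "Transposition.transpose a b"
  have C: "dom C = below F v" "ran C \<subseteq> {1..\<kappa>}" "proper_on F (below F v) C"
    "C ` children F v \<subseteq> Some ` ({1..\<kappa>} - {a})"
    using assms(3) unfolding subtree_colorings_def by auto
  have inj: "map_option ?t x = map_option ?t y \<longleftrightarrow> x = y" for x y
    using option.inj_map[OF inj_transpose[of a b]] by (simp add: inj_eq)
  have t: "?t c \<in> {1..\<kappa>}" if "c \<in> {1..\<kappa>}" for c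
    using assms(1,2) that unfolding Transposition.transpose_def by simp
  have "dom (map_option ?t \<circ> C) = below F v"
    unfolding C(1)[symmetric] dom_def by simp
  moreover have "ran (map_option ?t \<circ> C) \<subseteq> {1..\<kappa>}"
  proof
    fix d assume "d \<in> ran (map_option ?t \<circ> C)"
    then obtain x where "map_option ?t (C x) = Some d" unfolding ran_def by auto
    then obtain c where "C x = Some c" "d = ?t c" by (auto simp: map_option_eq_Some)
    then show "d \<in> {1..\<kappa>}" using t[of c] C(2) by (meson ranI subsetD)
  qed
  moreover have "proper_on F (below F v) (map_option ?t \<circ> C)"
    using C(3) unfolding proper_on_def comp_def inj .
  moreover have "map_option ?t (C x) \<in> Some ` ({1..\<kappa>} - {b})" if "x \<in> children F v" for x
  proof -
    have "C x \<in> Some ` ({1..\<kappa>} - {a})" using subsetD[OF C(4) imageI[OF that]] .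
    then obtain c where c: "C x = Some c" "c \<in> {1..\<kappa>}" "c \<noteq> a" by (elim imageE DiffE) simp
    then have "?t c \<noteq> b" unfolding transpose_eq_iff by auto
    then show ?thesis using t[OF c(2)] c(1) by simp
  qed
  then have "(map_option ?t \<circ> C) ` children F v \<subseteq> Some ` ({1..\<kappa>} - {b})"
    by (metis comp_apply image_subsetI)
  ultimately show ?thesis unfolding subtree_colorings_def by blast
qed

text \<open>The renaming is its own inverse. Because of this equality every coloring of the child
  edges of a vertex has the same number of extensions to the subtree.\<close>

lemma card_subtree_colorings:
  fixes F :: "'v::finite forest"
  assumes "a \<in> {1..\<kappa>}" "b \<in> {1..\<kappa>}"
  shows "card (subtree_colorings \<kappa> F ({1..\<kappa>} - {a}) v) = card (subtree_colorings \<kappa> F ({1..\<kappa>} - {b}) v)"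
proof (rule bij_betw_same_card)
  let ?r = "\<lambda>C :: 'v coloring. map_option (Transposition.transpose a b) \<circ> C"
  have "?r (?r C) = C" for C
    by (simp add: fun_eq_iff option.map_comp comp_def option.map_ident)
  moreover have "?r ` subtree_colorings \<kappa> F ({1..\<kappa>} - {a}) v \<subseteq> subtree_colorings \<kappa> F ({1..\<kappa>} - {b}) v"
    by (rule image_subsetI, rule recolor_subtree_colorings[OF assms])
  moreover have "?r ` subtree_colorings \<kappa> F ({1..\<kappa>} - {b}) v \<subseteq> subtree_colorings \<kappa> F ({1..\<kappa>} - {a}) v"
    by (rule image_subsetI, subst transpose_commute, rule recolor_subtree_colorings[OF assms(2,1)])
  ultimately show "bij_betw ?r
     (subtree_colorings \<kappa> F ({1..\<kappa>} - {a}) v) (subtree_colorings \<kappa> F ({1..\<kappa>} - {b}) v)"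
    by (intro bij_betw_byWitness[where f' = ?r]) auto
qed

text \<open>The child edges are drawn uniformly, then an extension is drawn uniformly. Such a
  mixture is uniform on the union if the pieces are disjoint and equally large, which is where
  \<open>card_subtree_colorings\<close> enters. Nonemptiness goes through the same induction, since
  the uniform laws of the subtrees presuppose it.\<close>

lemma dist_below_uniform:
  fixes F :: "'v::finite forest"
  assumes "is_forest F" and deg: "\<And>v. degree F v \<le> \<kappa>"
    and "S \<subseteq> {1..\<kappa>}" "card (children F v) \<le> card S"
  shows "subtree_colorings \<kappa> F S v \<noteq> {} \<and>
         dist_below \<kappa> F S v = pmf_of_set (subtree_colorings \<kappa> F S v)"
  using assms(3,4)
proof (induction v arbitrary: S rule: forest_induct[OF assms(1)])
  case (1 v)
  let ?U = "children F v" and ?B = "\<Union>u\<in>children F v. below F u"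
  let ?I = "{f. dom f = children F v \<and> ran f \<subseteq> S \<and> inj_on f (dom f)}"
  \<comment> \<open>For a coloring \<open>f\<close> of the child edges, \<open>S' f u\<close> is
    what \<open>f\<close> leaves to the child edges of \<open>u\<close>, \<open>K f\<close> holds
    the compatible colorings of the deeper edges, and \<open>G f\<close> is the fibre over
    \<open>f\<close> of the restriction to the child edges.\<close>
  define S' where "S' f u = {1..\<kappa>} - {the (f u)}" for f :: "'v coloring" and u
  define K where "K f = {C. dom C = ?B \<and> ran C \<subseteq> {1..\<kappa>} \<and> proper_on F ?B C \<and>
          (\<forall>u\<in>?U. C ` children F u \<subseteq> Some ` S' f u)}" for f
  define G where "G f = {C \<in> subtree_colorings \<kappa> F S v. C |` ?U = f}" for f
  have finS: "finite S" using 1(2) finite_subset by blast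
  have v: "v \<notin> below F v" by (rule below_irrefl[OF assms(1)])
  have disj: "?U \<inter> ?B = {}"
  proof -
    have False if "F x = Some v" "F u = Some v" "x \<in> below F u" for x u
      using that below_sibling[of x F u u] below_irrefl[OF assms(1), of u] by simp
    then show ?thesis by auto
  qed
  have sib: "F u = F u'" if "u \<in> ?U" "u' \<in> ?U" for u u' using that by simp
  have f: "the (f u) \<in> {1..\<kappa>}" "f u = Some (the (f u))" "the (f u) \<in> S" if "f \<in> ?I" "u \<in> ?U" for f u
  proof -
    have "u \<in> dom f" using that by auto
    then show "f u = Some (the (f u))" by auto
    then show "the (f u) \<in> S" using that(1) by (auto intro: ranI)
    then show "the (f u) \<in> {1..\<kappa>}" using 1(2) by auto
  qed
  have IH: "subtree_colorings \<kappa> F (S' f u) u \<noteq> {}"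
    "dist_below \<kappa> F (S' f u) u = pmf_of_set (subtree_colorings \<kappa> F (S' f u) u)"
    if "f \<in> ?I" "u \<in> ?U" for f u
  proof -
    \<comment> \<open>The edge from \<open>u\<close> to \<open>v\<close> takes one color from the
      palette and one unit from the degree bound, so the hypothesis on the number of children passes
      on to \<open>u\<close>.\<close>
    have "card (S' f u) = \<kappa> - 1" using f(1)[OF that] by (simp add: S'_def)
    moreover have "card (children F u) \<le> \<kappa> - 1" using deg[of u] that(2) by (simp add: degree_def)
    ultimately show "subtree_colorings \<kappa> F (S' f u) u \<noteq> {}"
      "dist_below \<kappa> F (S' f u) u = pmf_of_set (subtree_colorings \<kappa> F (S' f u) u)"
      using 1(1)[of u "S' f u"] that(2) by (auto simp: S'_def)
  qed
  have glued: "map_pmf (glue ?U) (Pi_pmf ?U Map.empty (\<lambda>u. dist_below \<kappa> F ({1..\<kappa>} - {the (f u)}) u)) =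
     pmf_of_set (K f)" if "f \<in> ?I" for f
  proof -
    have "Pi_pmf ?U Map.empty (\<lambda>u. dist_below \<kappa> F ({1..\<kappa>} - {the (f u)}) u) =
        Pi_pmf ?U Map.empty (\<lambda>u. pmf_of_set (subtree_colorings \<kappa> F (S' f u) u))"
      by (rule Pi_pmf_cong) (use IH[OF that] in \<open>auto simp: S'_def\<close>)
    then show ?thesis
      using map_pmf_glue_uniform[OF assms(1) sib IH(1)[OF that], of ?U] by (simp add: K_def)
  qed
  have bijK: "bij_betw (glue ?U) (PiE_dflt ?U Map.empty (\<lambda>u. subtree_colorings \<kappa> F (S' f u) u)) (K f)" for f
    unfolding K_def by (rule bij_betw_glue[OF assms(1) sib])
  \<comment> \<open>Color 1 is a common reference: the product does not mention \<open>f\<close>, so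
    all \<open>f\<close> have equally many extensions. If there is a child, the palette contains the
    color of its edge and hence also 1.\<close>
  have K: "finite (K f)" "K f \<noteq> {}" "card (K f) = (\<Prod>u\<in>?U. card (subtree_colorings \<kappa> F ({1..\<kappa>} - {1}) u))"
    if "f \<in> ?I" for f
  proof -
    let ?M = "PiE_dflt ?U Map.empty (\<lambda>u. subtree_colorings \<kappa> F (S' f u) u)"
    have "finite ?M" by (intro finite_PiE_dflt finite_subtree_colorings) simp
    then show "finite (K f)" using bijK bij_betw_finite by blast
    have "card (K f) = card ?M" by (rule bij_betw_same_card[OF bijK, symmetric])
    also have "\<dots> = (\<Prod>u\<in>?U. card (subtree_colorings \<kappa> F (S' f u) u))"
      by (intro card_PiE_dflt finite_subtree_colorings) simp
    also have "\<dots> = (\<Prod>u\<in>?U. card (subtree_colorings \<kappa> F ({1..\<kappa>} - {1}) u))"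
      unfolding S'_def
    proof (intro prod.cong refl card_subtree_colorings)
      fix u assume u: "u \<in> ?U"
      show "the (f u) \<in> {1..\<kappa>}" by (rule f(1)[OF that u])
      then show "1 \<in> {1..\<kappa>}" by auto
    qed
    finally show "card (K f) = (\<Prod>u\<in>?U. card (subtree_colorings \<kappa> F ({1..\<kappa>} - {1}) u))" .
    have "?M \<noteq> {}" by (rule PiE_dflt_nonempty) (rule IH(1)[OF that])
    then show "K f \<noteq> {}" using bij_betw_imp_surj_on[OF bijK, of f] by blast
  qed
  have bijG: "bij_betw (\<lambda>g. f ++ g) (K f) (G f)" if fI: "f \<in> ?I" for f
  proof (rule bij_betw_byWitness[where f' = "\<lambda>C. C |` ?B"])
    have app: "(f ++ g) x = (if x \<in> ?B then g x else f x)" if "g \<in> K f" for g x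
    proof -
      have "dom g = ?B" using that by (simp add: K_def)
      then show ?thesis by (metis domIff map_add_None map_add_dom_app_simps(1) map_add_dom_app_simps(3))
    qed
    show "\<forall>g\<in>K f. (f ++ g) |` ?B = g"
    proof
      fix g assume g: "g \<in> K f"
      then have "dom g = ?B" by (simp add: K_def)
      then have "g x = None" if "x \<notin> ?B" for x using that by blast
      then show "(f ++ g) |` ?B = g"
        by (auto simp: fun_eq_iff restrict_map_def app[OF g])
    qed
    show "\<forall>C\<in>G f. f ++ C |` ?B = C"
    proof
      fix C assume C: "C \<in> G f"
      then have "dom C = ?U \<union> ?B" "C |` ?U = f"
        using below_unfold[of F v] by (auto simp: G_def subtree_colorings_def)
      have "(f ++ C |` ?B) x = C x" for x
      proof (cases "x \<in> ?B")
        case True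
        then obtain c where "C x = Some c" using \<open>dom C = ?U \<union> ?B\<close> by blast
        then show ?thesis using True by (simp add: map_add_def)
      next
        case False
        then have "(f ++ C |` ?B) x = (C |` ?U) x"
          unfolding \<open>C |` ?U = f\<close> by (simp add: map_add_def restrict_map_def)
        moreover have "C x = None" if "x \<notin> ?U" using that False \<open>dom C = ?U \<union> ?B\<close> by blast
        ultimately show ?thesis by (cases "x \<in> ?U") simp_all
      qed
      then show "f ++ C |` ?B = C" by blast
    qed
    show "(\<lambda>g. f ++ g) ` K f \<subseteq> G f"
    proof
      fix C assume "C \<in> (\<lambda>g. f ++ g) ` K f"
      then obtain g where g: "g \<in> K f" and C: "C = f ++ g" by blast
      have Cf: "C x = f x" if "x \<in> ?U" for x using app[OF g] disj that C by auto
      have Cg: "C x = g x" if "x \<in> ?B" for x using app[OF g] that C by auto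
      have "dom C = below F v" using g fI C below_unfold[of F v] by (auto simp: K_def)
      moreover have "ran C \<subseteq> {1..\<kappa>}"
        using g fI 1(2) C by (auto simp: K_def ran_def map_add_def split: option.splits)
      moreover have "proper_on F (below F v) C"
        unfolding proper_on_def
      proof (intro ballI impI)
        fix x y assume xy: "x \<in> below F v" "y \<in> below F v"
          and adj: "F x = F y \<or> F x = Some y" and eq: "C x = C y"
        \<comment> \<open>On different levels, a child edge has no deeper edge as sibling or parent,
          and a deeper edge whose parent edge is a child edge avoids that color by the choice of
          \<open>S'\<close>.\<close>
        consider "x \<in> ?U" "y \<in> ?U" | "x \<in> ?U" "y \<in> ?B" | "x \<in> ?B" "y \<in> ?U" | "x \<in> ?B" "y \<in> ?B"
          using xy below_unfold[of F v] by blast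
        then show "x = y"
        proof cases
          case 1
          then show ?thesis using eq fI Cf by (auto simp: inj_on_def)
        next
          case 2
          then have "y \<in> ?U \<or> y = v" using adj by auto
          then show ?thesis using 2 disj v xy by blast
        next
          case 3
          then have adj: "x \<in> children F y" using adj disj by auto
          have "g ` children F y \<subseteq> Some ` S' f y" using g 3(2) by (simp add: K_def)
          then have "C x \<in> Some ` S' f y" unfolding Cg[OF 3(1)] using adj by (rule subsetD[OF _ imageI])
          moreover have "C y = Some (the (f y))" using Cf f(2)[OF fI 3(2)] 3 by simp
          ultimately show ?thesis using eq by (auto simp: S'_def)
        next
          case 4
          have "proper_on F ?B g" using g by (simp add: K_def)
          then show ?thesis using 4 adj eq Cg by (auto elim!: proper_onD)
        qed
      qed
      moreover have "C ` children F v \<subseteq> Some ` S"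
        using f[OF fI] Cf by force
      moreover have "C |` ?U = f"
      proof
        fix x
        have "dom f = ?U" using fI by simp
        then have "f x = None" if "x \<notin> ?U" using that by blast
        then show "(C |` ?U) x = f x" using Cf by (cases "x \<in> ?U") simp_all
      qed
      ultimately show "C \<in> G f" by (simp add: G_def subtree_colorings_def)
    qed
    show "(\<lambda>C. C |` ?B) ` G f \<subseteq> K f"
    proof
      fix g assume "g \<in> (\<lambda>C. C |` ?B) ` G f"
      then obtain C where C: "C \<in> G f" and g: "g = C |` ?B" by blast
      have dom: "dom C = below F v" and proper: "proper_on F (below F v) C" and ran: "ran C \<subseteq> {1..\<kappa>}"
        using C by (auto simp: G_def subtree_colorings_def)
      have "dom g = ?B" using dom g below_unfold[of F v] by auto
      moreover have "ran g \<subseteq> {1..\<kappa>}" using ran g by (auto simp: ran_def restrict_map_def)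
      moreover have "proper_on F ?B g"
        using proper below_unfold[of F v] g
        by (subst proper_on_cong[of _ _ C]) (auto intro: proper_on_subset)
      moreover have "g ` children F u \<subseteq> Some ` S' f u" if u: "u \<in> ?U" for u
      proof
        fix y assume "y \<in> g ` children F u"
        then obtain x where x: "F x = Some u" "y = g x" by auto
        then have xB: "x \<in> ?B" using u below_base[of F x u] by blast
        have B: "u \<in> below F v" "x \<in> below F v" using u xB below_unfold[of F v] by auto
        then obtain c where c: "C x = Some c" using dom by blast
        have "C u = f u" using C u by (auto simp: G_def restrict_map_def)
        then have "c \<noteq> the (f u)"
          using proper_onD[OF proper B(2,1)] x c f(2)[OF fI u] below_irrefl[OF assms(1), of u] below_base[of F x u]
          by auto
        then show "y \<in> Some ` S' f u"
          using c g x(2) xB ranI[of C x c] ran by (auto simp: S'_def simp del: UN_iff)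
      qed
      ultimately show "g \<in> K f" by (simp add: K_def)
    qed
  qed
  have UN: "(\<Union>f\<in>?I. G f) = subtree_colorings \<kappa> F S v"
  proof (intro equalityI subsetI)
    fix C assume C: "C \<in> subtree_colorings \<kappa> F S v"
    then have proper: "proper_on F (below F v) C" and im: "C ` ?U \<subseteq> Some ` S" and dom: "dom C = below F v"
      by (auto simp: subtree_colorings_def)
    have "dom (C |` ?U) = ?U" using dom below_unfold[of F v] by auto
    moreover have "ran (C |` ?U) \<subseteq> S"
      using im
      by (auto simp: ran_def restrict_map_def split: if_splits)
         (metis children_iff imageE image_subset_iff option.inject)
    moreover have "inj_on (C |` ?U) ?U"
      using proper by (auto simp: inj_on_def below_base elim!: proper_onD)
    ultimately show "C \<in> (\<Union>f\<in>?I. G f)" using C by (auto simp: G_def)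
  qed (auto simp: G_def)
  obtain h where h: "h ` ?U \<subseteq> S" "inj_on h ?U"
    using card_le_inj[OF _ finS 1(3)] by auto
  have "(\<lambda>x. if x \<in> ?U then Some (h x) else None) \<in> ?I"
    using h by (auto simp: inj_on_def dom_def ran_def)
  then have Ine: "?I \<noteq> {}" by blast
  have ne: "subtree_colorings \<kappa> F S v \<noteq> {}"
  proof -
    obtain f where f: "f \<in> ?I" using Ine by blast
    then have "G f \<noteq> {}" using K(2)[OF f] bij_betw_imp_surj_on[OF bijG[OF f]] by blast
    then show ?thesis by (auto simp: G_def)
  qed
  have "dist_below \<kappa> F S v = do {
          f \<leftarrow> pmf_of_set ?I;
          g \<leftarrow> map_pmf (glue ?U) (Pi_pmf ?U Map.empty (\<lambda>u. dist_below \<kappa> F ({1..\<kappa>} - {the (f u)}) u));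
          return_pmf (f ++ g)}"
    using assms(1) by (subst dist_below.simps) (simp add: uniform_coloring_def bind_map_pmf)
  also have "\<dots> = do {f \<leftarrow> pmf_of_set ?I; pmf_of_set (G f)}"
  proof (rule bind_pmf_cong[OF refl])
    fix f assume "f \<in> set_pmf (pmf_of_set ?I)"
    moreover have "finite ?I"
      by (rule finite_subset[OF _ finite_set_of_finite_maps[of ?U S]]) (use finS in auto)
    ultimately have fI: "f \<in> ?I" by (simp only: set_pmf_of_set[OF Ine])
    show "map_pmf (glue ?U) (Pi_pmf ?U Map.empty (\<lambda>u. dist_below \<kappa> F ({1..\<kappa>} - {the (f u)}) u)) \<bind>
         (\<lambda>g. return_pmf (f ++ g)) = pmf_of_set (G f)"
      unfolding glued[OF fI]
      using map_pmf_of_set_bij_betw[OF bijG[OF fI] K(2,1)[OF fI]] by (simp add: map_pmf_def)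
  qed
  also have "\<dots> = pmf_of_set (\<Union>f\<in>?I. G f)"
  proof (rule pmf_of_set_UN[symmetric])
    show "finite (\<Union>f\<in>?I. G f)" unfolding UN by (rule finite_subtree_colorings)
    show "?I \<noteq> {}" by (rule Ine)
    show "G f \<noteq> {}" if "f \<in> ?I" for f
      using K(2)[OF that] bijG[OF that] by (metis bij_betw_imp_surj_on image_is_empty)
    show "card (G f) = (\<Prod>u\<in>?U. card (subtree_colorings \<kappa> F ({1..\<kappa>} - {1}) u))" if "f \<in> ?I" for f
      using K(3)[OF that] bij_betw_same_card[OF bijG[OF that]] by simp
    show "disjoint_family_on G ?I" by (auto simp: disjoint_family_on_def G_def)
  qed
  finally show ?case using ne unfolding UN by blast
qed

text \<open>Brings the set into the shape of \<open>bij_betw_glue\<close>, where a root admits the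
  whole palette for its child edges; the condition on these edges follows from the one on the
  range.\<close>

lemma proper_colorings_eq:
  fixes F :: "'v::finite forest"
  assumes "is_forest F"
  shows "proper_colorings \<kappa> F =
    {C. dom C = (\<Union>u\<in>roots F. below F u) \<and> ran C \<subseteq> {1..\<kappa>} \<and>
        proper_on F (\<Union>u\<in>roots F. below F u) C \<and>
        (\<forall>u\<in>roots F. C ` children F u \<subseteq> Some ` {1..\<kappa>})}"
  unfolding proper_colorings_def dom_eq_UN_below_roots[OF assms, symmetric]
proof (intro Collect_cong iffI conjI ballI image_subsetI; elim conjE)
  fix C :: "'v coloring" and u x
  assume "dom C = dom F" "ran C \<subseteq> {1..\<kappa>}" "x \<in> children F u"
  then have "x \<in> dom C" by auto
  then obtain c where "C x = Some c" by blast
  then show "C x \<in> Some ` {1..\<kappa>}" using \<open>ran C \<subseteq> {1..\<kappa>}\<close> by (auto simp: ran_def)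
qed

lemma dist_tree_uniform:
  fixes F :: "'v::finite forest"
  assumes "is_forest F" and deg: "\<And>v. degree F v \<le> \<kappa>"
  shows "subtree_colorings \<kappa> F {1..\<kappa>} r \<noteq> {}"
    and "dist_tree \<kappa> F r = pmf_of_set (subtree_colorings \<kappa> F {1..\<kappa>} r)"
proof -
  have "card (children F r) \<le> card {1..\<kappa>}" using deg[of r] by (simp add: degree_def)
  then show "subtree_colorings \<kappa> F {1..\<kappa>} r \<noteq> {}"
    and "dist_tree \<kappa> F r = pmf_of_set (subtree_colorings \<kappa> F {1..\<kappa>} r)"
    using dist_below_uniform[OF assms, of "{1..\<kappa>}" r] by (auto simp: dist_tree_def)
qed

lemma proper_colorings_nonempty:
  fixes F :: "'v::finite forest"
  assumes "is_forest F" "\<And>v. degree F v \<le> \<kappa>"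
  shows "proper_colorings \<kappa> F \<noteq> {}"
proof -
  let ?M = "PiE_dflt (roots F) Map.empty (subtree_colorings \<kappa> F {1..\<kappa>})"
  have "bij_betw (glue (roots F)) ?M (proper_colorings \<kappa> F)"
    unfolding proper_colorings_eq[OF assms(1)] by (rule bij_betw_glue[OF assms(1)]) auto
  moreover have "?M \<noteq> {}" by (rule PiE_dflt_nonempty) (rule dist_tree_uniform(1)[OF assms])
  ultimately show ?thesis by (metis bij_betw_imp_surj_on image_is_empty)
qed

lemma dist_forest_uniform:
  fixes F :: "'v::finite forest"
  assumes "is_forest F" "\<And>v. degree F v \<le> \<kappa>"
  shows "dist_forest \<kappa> F = pmf_of_set (proper_colorings \<kappa> F)"
  unfolding dist_forest_def dist_tree_uniform(2)[OF assms] proper_colorings_eq[OF assms(1)]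
  by (rule map_pmf_glue_uniform[OF assms(1) _ dist_tree_uniform(1)[OF assms]]) auto

subsection \<open>Exchanging two colors along a path\<close>

text \<open>The part of an alternating chain that hangs down from \<open>w\<close>, which belongs to
  it whatever its color. In a proper coloring, if \<open>A\<close> holds two colors and one is that
  of \<open>w\<close>, it does not branch. \<open>A\<close> consists of options so that values such
  as \<open>D r\<close> can be inserted directly.\<close>

definition kempe_path :: "'v forest \<Rightarrow> 'v coloring \<Rightarrow> nat option set \<Rightarrow> 'v \<Rightarrow> 'v set" where
  "kempe_path F C A w = {x. (w, x) \<in> {(u, x). F x = Some u \<and> C x \<in> A}\<^sup>*}"

definition swap_on :: "'v set \<Rightarrow> nat \<Rightarrow> nat \<Rightarrow> 'v coloring \<Rightarrow> 'v coloring" where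
  "swap_on P a b C = (\<lambda>x. if x \<in> P then map_option (Transposition.transpose a b) (C x) else C x)"

lemma kempe_path_base: "w \<in> kempe_path F C A w"
  by (simp add: kempe_path_def)

lemma kempe_path_child: "u \<in> kempe_path F C A w \<Longrightarrow> F x = Some u \<Longrightarrow> C x \<in> A \<Longrightarrow> x \<in> kempe_path F C A w"
  unfolding kempe_path_def by (auto intro: rtrancl_into_rtrancl)

lemma kempe_pathE:
  assumes "x \<in> kempe_path F C A w"
  obtains "x = w" | u where "F x = Some u" "C x \<in> A" "u \<in> kempe_path F C A w"
  using assms unfolding kempe_path_def by (auto elim: rtranclE)

lemma kempe_path_color: "x \<in> kempe_path F C A w \<Longrightarrow> C w \<in> A \<Longrightarrow> C x \<in> A"
  by (auto elim: kempe_pathE)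

lemma kempe_path_subset: "kempe_path F C A w \<subseteq> insert w (below F w)"
proof
  fix x assume "x \<in> kempe_path F C A w"
  then have "(w, x) \<in> {(u, x). F x = Some u \<and> C x \<in> A}\<^sup>*" by (simp add: kempe_path_def)
  then have "(w, x) \<in> (edges F)\<^sup>*" by (rule rtrancl_mono[THEN subsetD, rotated]) auto
  then show "x \<in> insert w (below F w)" by (auto simp: rtrancl_eq_or_trancl below_def)
qed

text \<open>Agreement at the children of path vertices suffices, because both paths are followed
  step by step from \<open>w\<close>; elsewhere forest and coloring may change.\<close>

lemma kempe_path_cong:
  assumes "\<And>u x. u \<in> kempe_path F C A w \<Longrightarrow> (F x = Some u \<and> C x \<in> A) \<longleftrightarrow> (F' x = Some u \<and> C' x \<in> A)"
  shows "kempe_path F' C' A w = kempe_path F C A w"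
proof (intro equalityI subsetI)
  fix x assume "x \<in> kempe_path F C A w"
  then have "(w, x) \<in> {(u, x). F x = Some u \<and> C x \<in> A}\<^sup>*" by (simp add: kempe_path_def)
  then show "x \<in> kempe_path F' C' A w"
  proof induction
    case (step u x)
    then have "u \<in> kempe_path F C A w" by (simp add: kempe_path_def)
    then show ?case using step assms[of u x] by (auto intro: kempe_path_child)
  qed (rule kempe_path_base)
next
  fix x assume "x \<in> kempe_path F' C' A w"
  then have "(w, x) \<in> {(u, x). F' x = Some u \<and> C' x \<in> A}\<^sup>*" by (simp add: kempe_path_def)
  then show "x \<in> kempe_path F C A w"
  proof induction
    case (step u x)
    then show ?case using assms[of u x] by (auto intro: kempe_path_child)
  qed (rule kempe_path_base)
qed

lemma kempe_path_unfold:
  "kempe_path F C A w = insert w (\<Union>u\<in>{u. F u = Some w \<and> C u \<in> A}. kempe_path F C A u)"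
  (is "_ = ?R")
proof (intro equalityI subsetI)
  fix x assume "x \<in> kempe_path F C A w"
  then show "x \<in> ?R" unfolding kempe_path_def by (auto elim: converse_rtranclE)
next
  fix x assume "x \<in> ?R"
  then show "x \<in> kempe_path F C A w" unfolding kempe_path_def
    by (auto intro: converse_rtrancl_into_rtrancl)
qed

lemma swap_on_involutory: "swap_on P a b (swap_on P a b C) = C"
  by (simp add: swap_on_def fun_eq_iff option.map_comp comp_def option.map_ident)

lemma swap_on_commute: "swap_on P a b C = swap_on P b a C"
  unfolding swap_on_def by (subst transpose_commute) (rule refl)

text \<open>Since a run passes through improper colorings, \<open>C\<close> stands for the coloring
  before the edge above \<open>w\<close> changes from \<open>b\<close> to \<open>a\<close>, and
  properness is assumed only from that edge downwards, as there may be a conflict above it. For the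
  call at a child \<open>u\<close>, the induction hypothesis is used with
  \<open>C(w \<mapsto> a)\<close> in the role of \<open>C\<close> and the two colors
  exchanged.\<close>

lemma fix_forbidden_eq_swap_on:
  fixes F :: "'v::finite forest"
  assumes "is_forest F"
    and "C w = Some b" "a \<noteq> b" "proper_on F (insert w (below F w)) C"
  shows "fix_forbidden F w b a (C(w \<mapsto> a)) =
     swap_on (kempe_path F C {Some a, Some b} w) a b C"
  using assms(2-)
proof (induction w arbitrary: a b C rule: forest_induct[OF assms(1)])
  case (1 w)
  let ?A = "{Some a, Some b}"
  have w: "w \<notin> below F w" by (rule below_irrefl[OF assms(1)])
  have ne: "u \<noteq> w" if "F u = Some w" for u using that w below_base[of F u w] by auto
  have sib: "u = u'" if "F u = Some w" "F u' = Some w" "C u = C u'" for u u'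
    using that by (intro proper_onD[OF 1(4)]) (auto simp: below_base)
  have nb: "C u \<noteq> Some b" if "F u = Some w" for u
  proof
    assume "C u = Some b"
    then have "u = w" using 1(2) that by (intro proper_onD[OF 1(4)]) (auto simp: below_base)
    then show False using ne[OF that] by simp
  qed
  show ?case
  proof (cases "\<exists>u. F u = Some w \<and> C u = Some a")
    case True
    then obtain u where u: "F u = Some w" "C u = Some a" by blast
    let ?C = "C(w \<mapsto> a)"
    have ub: "u \<in> below F w" using u(1) by (rule below_base)
    then have w_desc: "w \<notin> insert u (below F u)"
      using w ne[OF u(1)] below_trans[of w F u w] by blast
    have the: "(THE x. x \<in> children F w \<and> ?C x = Some a) = u"
      using u ne sib by (intro the_equality) auto
    have "fix_forbidden F w b a ?C = fix_forbidden F u a b (?C(u \<mapsto> b))"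
    proof -
      have "\<exists>x\<in>children F w. ?C x = Some a" using u ne[OF u(1)] by auto
      then show ?thesis by (subst fix_forbidden.simps) (simp only: the Let_def if_True)
    qed
    also have "\<dots> = swap_on (kempe_path F ?C {Some b, Some a} u) b a ?C"
    proof (rule 1(1)[OF u(1)])
      show "?C u = Some a" using u ne[OF u(1)] by simp
      show "b \<noteq> a" using 1(3) by simp
      have "proper_on F (insert u (below F u)) C"
        by (rule proper_on_subset[OF 1(4)]) (use ub below_trans[OF _ ub] in auto)
      then show "proper_on F (insert u (below F u)) ?C"
        using w_desc by (subst proper_on_cong[of _ _ C]) auto
    qed
    \<comment> \<open>Recoloring \<open>w\<close> does not disturb the path from \<open>u\<close>,
      as \<open>w\<close> is not a child of any vertex on it.\<close>
    also have "kempe_path F ?C {Some b, Some a} u = kempe_path F C ?A u"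
    proof -
      have A: "{Some b, Some a} = ?A" by auto
      have nw: "F x \<noteq> Some v" if "v \<in> kempe_path F C ?A u" "x = w" for v x
        using that w_desc kempe_path_subset[of F C ?A u] below_child[of v F u w] below_base[of F w u] by auto
      show ?thesis unfolding A
      proof (rule kempe_path_cong)
        fix v x assume "v \<in> kempe_path F C ?A u"
        then show "(F x = Some v \<and> C x \<in> ?A) \<longleftrightarrow> (F x = Some v \<and> ?C x \<in> ?A)"
          using nw[of v x] by (cases "x = w") simp_all
      qed
    qed
    also have "swap_on (kempe_path F C ?A u) b a ?C = swap_on (insert w (kempe_path F C ?A u)) a b C"
      unfolding swap_on_commute[of _ b a] using w_desc kempe_path_subset[of F C ?A u] 1(2)
      by (auto simp: swap_on_def fun_eq_iff)
    also have "insert w (kempe_path F C ?A u) = kempe_path F C ?A w"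
    proof -
      have "{x. F x = Some w \<and> C x \<in> ?A} = {u}" using u sib nb by auto
      then show ?thesis by (subst (2) kempe_path_unfold) simp
    qed
    finally show ?thesis .
  next
    case False
    then have e: "{x. F x = Some w \<and> C x \<in> ?A} = {}" using nb by auto
    have "kempe_path F C ?A w = {w}" by (subst kempe_path_unfold) (simp only: e UN_empty)
    moreover have "fix_forbidden F w b a (C(w \<mapsto> a)) = C(w \<mapsto> a)"
      using False ne by (subst fix_forbidden.simps) auto
    moreover have "swap_on {w} a b C = C(w \<mapsto> a)"
      using 1(2) by (auto simp: swap_on_def fun_eq_iff)
    ultimately show ?thesis by (simp only:)
  qed
qed

lemma swap_on_eq_Some_iff:
  "a \<noteq> b \<Longrightarrow> swap_on P a b C x \<in> {Some a, Some b} \<longleftrightarrow> C x \<in> {Some a, Some b}"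
  by (auto simp: swap_on_def transpose_eq_iff)

lemma dom_swap_on: "dom (swap_on P a b C) = dom C"
  by (auto simp: swap_on_def dom_def)

lemma ran_swap_on: "a \<in> S \<Longrightarrow> b \<in> S \<Longrightarrow> ran C \<subseteq> S \<Longrightarrow> ran (swap_on P a b C) \<subseteq> S"
  by (auto simp: swap_on_def ran_def Transposition.transpose_def split: if_splits)

text \<open>The hypotheses allow one conflict, between the edges above \<open>w\<close> and above \<open>r\<close>; this is the state in
  which an insertion leaves the coloring.\<close>

lemma proper_on_swap_on:
  assumes "is_forest F" "F w = Some r" "C w = Some b" "a \<noteq> b"
    and proper: "\<And>x y. \<lbrakk>x \<in> A; y \<in> A; F x = F y \<or> F x = Some y; C x = C y\<rbrakk>
      \<Longrightarrow> x = y \<or> (x = w \<and> y = r)"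
    and children: "\<And>x. F x = Some r \<Longrightarrow> C x \<noteq> Some a" and "C r \<noteq> Some a"
  shows "proper_on F A (swap_on (kempe_path F C {Some a, Some b} w) a b C)"
proof -
  let ?A = "{Some a, Some b}"
  let ?P = "kempe_path F C ?A w"
  let ?D = "swap_on ?P a b C"
  have D_in: "?D x = map_option (Transposition.transpose a b) (C x)" if "x \<in> ?P" for x
    using that by (simp add: swap_on_def)
  have D_out: "?D x = C x" if "x \<notin> ?P" for x
    using that by (simp add: swap_on_def)
  have P: "C x \<in> ?A" "?D x \<in> ?A" if "x \<in> ?P" for x
    using kempe_path_color[OF that] assms(3) swap_on_eq_Some_iff[OF assms(4), of ?P C x] by auto
  have Dw: "?D w = Some a" using assms(3) D_in[OF kempe_path_base] by simp
  have "r \<notin> insert w (below F w)"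
    using assms(1,2) below_irrefl[of F] below_base[of F w r] below_child[of r F w w] by auto
  then have r: "r \<notin> ?P" using kempe_path_subset[of F C ?A w] by blast
  \<comment> \<open>The new color of \<open>x\<close> is \<open>a\<close> or \<open>b\<close>. For
    \<open>x = w\<close> it is \<open>a\<close>, which neither \<open>r\<close> nor a child edge of
    \<open>r\<close> has in \<open>C\<close>. Otherwise the parent of \<open>x\<close> is on the
    path, and \<open>y\<close> is that parent or a sibling with one of the two colors, hence on the
    path as well.\<close>
  have cross: False
    if "x \<in> ?P" "y \<notin> ?P" "F x = F y \<or> F x = Some y" "?D x = ?D y" for x y
    using that(1)
  proof (cases rule: kempe_pathE)
    case 1
    then show ?thesis using that assms(2,7) children[of y] D_out[of y] Dw by auto
  next
    case (2 u)
    then show ?thesis using that kempe_path_child[of u F C ?A w y] P(2)[OF that(1)] D_out[OF that(2)] by auto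
  qed
  have cross': False
    if "x \<notin> ?P" "y \<in> ?P" "F x = Some y" "?D x = ?D y" for x y
    using that kempe_path_child[of y F C ?A w x] P(2)[OF that(2)] D_out[OF that(1)] by auto
  show ?thesis
    unfolding proper_on_def
  proof (intro ballI impI)
    fix x y assume xy: "x \<in> A" "y \<in> A" and adj: "F x = F y \<or> F x = Some y" and eq: "?D x = ?D y"
    show "x = y"
    proof (cases "x \<in> ?P"; cases "y \<in> ?P")
      assume "x \<in> ?P" "y \<in> ?P"
      then have "C x = C y"
        using eq option.inj_map[OF inj_transpose[of a b]] by (simp add: D_in inj_eq)
      then show ?thesis using proper[OF xy adj] \<open>y \<in> ?P\<close> r by auto
    next
      assume "x \<notin> ?P" "y \<notin> ?P"
      then show ?thesis using proper[OF xy adj] eq D_out kempe_path_base[of w F C ?A] by auto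
    next
      assume "x \<in> ?P" "y \<notin> ?P"
      then show ?thesis using cross[of x y] adj eq by blast
    next
      assume "x \<notin> ?P" "y \<in> ?P"
      then show ?thesis using cross[of y x] cross'[of x y] adj eq by metis
    qed
  qed
qed

subsection \<open>Insertion and deletion of an edge\<close>

text \<open>Summing \<open>rev\<close> over \<open>A\<close> gives each \<open>y\<close> in
  \<open>B\<close> the mass \<open>c / card A\<close>, because the row of \<open>L\<close> at
  \<open>y\<close> sums to 1. This does not depend on \<open>y\<close>, and the total mass 1
  determines \<open>c\<close>, so the sizes of \<open>A\<close> and \<open>B\<close> need not be
  known.\<close>

lemma bind_uniform_of_reversal:
  assumes fin: "finite A" "finite B" and "A \<noteq> {}"
    and K: "\<And>x. x \<in> A \<Longrightarrow> set_pmf (K x) \<subseteq> B"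
    and L: "\<And>y. y \<in> B \<Longrightarrow> set_pmf (L y) \<subseteq> A"
    and rev: "\<And>x y. x \<in> A \<Longrightarrow> y \<in> B \<Longrightarrow> pmf (K x) y = c * pmf (L y) x"
  shows "bind_pmf (pmf_of_set A) K = pmf_of_set B"
proof -
  let ?P = "bind_pmf (pmf_of_set A) K"
  have P: "pmf ?P y = c / card A" if "y \<in> B" for y
  proof -
    have "pmf ?P y = (\<Sum>x\<in>A. pmf (K x) y) / card A"
      by (rule pmf_bind_pmf_of_set) (use assms in auto)
    also have "(\<Sum>x\<in>A. pmf (K x) y) = c * (\<Sum>x\<in>A. pmf (L y) x)"
      using rev that by (simp add: sum_distrib_left)
    also have "(\<Sum>x\<in>A. pmf (L y) x) = 1"
      using sum_pmf_eq_1[OF fin(1) L[OF that]] .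
    finally show ?thesis by simp
  qed
  have supp: "set_pmf ?P \<subseteq> B" using K assms(3) fin(1) by (auto simp: set_bind_pmf)
  then have "B \<noteq> {}" using set_pmf_not_empty[of ?P] by blast
  have "(\<Sum>y\<in>B. pmf ?P y) = 1" by (rule sum_pmf_eq_1[OF fin(2) supp])
  moreover have "(\<Sum>y\<in>B. pmf ?P y) = (\<Sum>y\<in>B. c / card A)" by (rule sum.cong) (use P in auto)
  ultimately have "card B * (c / card A) = 1" by (simp only: sum_constant)
  then have "c / card A = 1 / card B" by (metis nonzero_eq_divide_eq mult.commute mult_zero_left zero_neq_one)
  then have P: "pmf ?P y = 1 / card B" if "y \<in> B" for y using P[OF that] by (simp only:)
  show ?thesis
  proof (rule pmf_eqI)
    fix y show "pmf ?P y = pmf (pmf_of_set B) y"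
      using P[of y] supp fin(2) \<open>B \<noteq> {}\<close> by (cases "y \<in> B") (auto simp: pmf_eq_0_set_pmf)
  qed
qed

lemma finite_avail: "finite (avail \<kappa> F C x)"
  by (simp add: avail_def)

text \<open>The edges at \<open>x\<close> are pairwise adjacent, so their colors are distinct, and
  these lie in the palette, so the subtraction does not truncate. The number of choices thus depends
  on the forest but not on \<open>C\<close>.\<close>

lemma card_avail:
  fixes F :: "'v::finite forest"
  assumes "is_forest F" "C \<in> proper_colorings \<kappa> F"
  shows "card (avail \<kappa> F C x) = \<kappa> - degree F x"
proof -
  let ?N = "children F x \<union> {x} \<inter> dom F"
  have C: "dom C = dom F" "ran C \<subseteq> {1..\<kappa>}" "proper_on F (dom F) C"
    using assms(2) by (auto simp: proper_colorings_def)
  have N: "?N \<subseteq> dom C" using C(1) by auto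
  have col: "C y = Some (the (C y))" if "y \<in> ?N" for y using N that by auto
  have "{a. C x = Some a \<or> (\<exists>y\<in>children F x. C y = Some a)} = (the \<circ> C) ` ?N"
  proof (intro equalityI subsetI)
    fix a assume "a \<in> {a. C x = Some a \<or> (\<exists>y\<in>children F x. C y = Some a)}"
    then obtain y where y: "y = x \<or> y \<in> children F x" "C y = Some a" by blast
    then have "y \<in> dom F" using C(1) by blast
    then have "y \<in> ?N" using y(1) by blast
    then show "a \<in> (the \<circ> C) ` ?N" using y(2) by (metis comp_apply image_eqI option.sel)
  next
    fix a assume "a \<in> (the \<circ> C) ` ?N"
    then obtain y where y: "y \<in> ?N" "a = the (C y)" unfolding image_iff comp_apply by blast
    then have "C y = Some a" using col by blast
    then show "a \<in> {a. C x = Some a \<or> (\<exists>y\<in>children F x. C y = Some a)}"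
      using y(1) by blast
  qed
  then have "avail \<kappa> F C x = {1..\<kappa>} - (the \<circ> C) ` ?N" by (simp add: avail_def)
  moreover have "(the \<circ> C) ` ?N \<subseteq> {1..\<kappa>}"
  proof
    fix a assume "a \<in> (the \<circ> C) ` ?N"
    then obtain y where "y \<in> ?N" "a = the (C y)" unfolding image_iff comp_apply by blast
    then show "a \<in> {1..\<kappa>}" using col[of y] C(2) ranI[of C y a] by auto
  qed
  moreover have "inj_on (the \<circ> C) ?N"
  proof (rule inj_onI)
    fix y z assume yz: "y \<in> ?N" "z \<in> ?N" and "(the \<circ> C) y = (the \<circ> C) z"
    then have "C y = C z" using col by (metis comp_apply)
    moreover have "y \<in> dom F" "z \<in> dom F" using yz N C(1) by blast+
    moreover have "y = z \<or> F y = F z \<or> F y = Some z \<or> F z = Some y" using yz by auto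
    ultimately show "y = z"
      using C(3) unfolding proper_on_def by metis
  qed
  moreover have "card ?N = degree F x"
    using below_irrefl[OF assms(1), of x] below_base[of F x x]
    by (auto simp: degree_def domIff card_insert_if)
  ultimately show ?thesis by (simp add: card_Diff_subset card_image del: comp_apply)
qed

text \<open>Common setting for both updates: an insertion leads from \<open>F\<close> to
  \<open>F(r \<mapsto> p)\<close> and a deletion leads back. The degree bound is imposed on the
  larger forest.\<close>

locale forest_link =
  fixes \<kappa> :: nat and F :: "'v::finite forest" and p r :: 'v
  assumes root: "F r = None" and forest_G: "is_forest (F(r \<mapsto> p))"
    and deg: "\<And>v. degree (F(r \<mapsto> p)) v \<le> \<kappa>"
begin

abbreviation "G \<equiv> F(r \<mapsto> p)"

lemma forest_F: "is_forest F"
proof -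
  have "edges F \<subseteq> edges G" using root by auto
  then show ?thesis using forest_G acyclic_subset unfolding is_forest_def by blast
qed

lemma p_neq_r: "p \<noteq> r"
  using below_irrefl[OF forest_G, of r] below_base[of G r r] by auto

lemma below_F_subset: "below F v \<subseteq> below G v"
proof -
  have "edges F \<subseteq> edges G" using root by auto
  then show ?thesis unfolding below_def using trancl_mono by blast
qed

lemma p_not_below: "p \<notin> below F r"
  using below_F_subset[of r] below_irrefl[OF forest_G, of r] below_child[of p G r r] by auto

lemma child_neq_r: "F w = Some r \<Longrightarrow> w \<noteq> r"
  using root by auto

lemma r_not_desc: "F w = Some r \<Longrightarrow> r \<notin> insert w (below F w)"
  using child_neq_r below_subset_dom[of F w] root by auto

lemma p_not_desc: "F w = Some r \<Longrightarrow> p \<notin> insert w (below F w)"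
  using p_not_below below_base[of F w r] below_trans[of p F w r] by auto

lemma r_not_desc_G: "F w = Some r \<Longrightarrow> r \<notin> insert w (below G w)"
  using child_neq_r[of w] below_irrefl[OF forest_G, of r] below_base[of G w r] below_trans[of r G w r]
  by auto

lemma children_G_r: "children G r = children F r"
  using p_neq_r root by (auto split: if_splits)

lemma degree_F_r: "degree F r = card (children F r)"
  using root by (simp add: degree_def)

lemma card_children_r_less: "card (children F r) < \<kappa>"
  using deg[of r] children_G_r by (simp add: degree_def)

lemma degree_F_p_less: "degree F p < \<kappa>"
proof -
  have "children G p = insert r (children F p)" by (auto split: if_splits)
  then have "degree G p = Suc (degree F p)"
    using p_neq_r root by (simp add: degree_def card_insert_if)
  then show ?thesis using deg[of p] by simp
qed

lemma dom_G: "dom G = insert r (dom F)"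
  by auto

text \<open>The path consists of \<open>w\<close> and descendants of \<open>w\<close>, so it misses
  \<open>p\<close>, the only vertex whose children differ between \<open>F\<close> and
  \<open>G\<close>. Hence neither the presence nor the color of the edge above \<open>r\<close> can
  alter it.\<close>

lemma kempe_path_G:
  assumes "F w = Some r" "\<And>x. x \<noteq> r \<Longrightarrow> C' x \<in> A \<longleftrightarrow> C x \<in> A"
  shows "kempe_path G C' A w = kempe_path F C A w" "kempe_path F C' A w = kempe_path F C A w"
proof -
  have *: "u \<noteq> p" if "u \<in> kempe_path F C A w" for u
    using that kempe_path_subset[of F C A w] p_not_desc[OF assms(1)] by auto
  show "kempe_path G C' A w = kempe_path F C A w"
  proof (rule kempe_path_cong)
    fix u x assume "u \<in> kempe_path F C A w"
    then show "(F x = Some u \<and> C x \<in> A) \<longleftrightarrow> (G x = Some u \<and> C' x \<in> A)"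
      using * root assms(2)[of x] by (cases "x = r") auto
  qed
  show "kempe_path F C' A w = kempe_path F C A w"
  proof (rule kempe_path_cong)
    fix u x
    show "(F x = Some u \<and> C x \<in> A) \<longleftrightarrow> (F x = Some u \<and> C' x \<in> A)"
      using root assms(2)[of x] by (cases "x = r") auto
  qed
qed

lemma r_not_kempe: "F w = Some r \<Longrightarrow> r \<notin> kempe_path F C A w"
  using r_not_desc kempe_path_subset[of F C A w] by blast

lemma sibling_not_kempe:
  assumes "F w = Some r" "F x = Some r" "x \<noteq> w"
  shows "x \<notin> kempe_path F C A w"
  using assms r_not_kempe[OF assms(1)] by (auto elim: kempe_pathE)

lemma p_not_kempe: "F w = Some r \<Longrightarrow> p \<notin> kempe_path F C A w"
  using p_not_desc kempe_path_subset[of F C A w] by blast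

text \<open>Together with \<open>p_not_kempe\<close>: an exchange leaves the edges of
  \<open>F\<close> at \<open>p\<close> alone, so a color is free there before it iff it is free
  afterwards.\<close>

lemma p_child_not_kempe:
  assumes "F w = Some r" "F x = Some p"
  shows "x \<notin> kempe_path F C A w"
  using assms p_not_kempe[OF assms(1)] p_neq_r by (auto elim: kempe_pathE)

definition swap_up :: "'v coloring \<Rightarrow> nat \<Rightarrow> 'v \<Rightarrow> nat \<Rightarrow> 'v coloring" where
  "swap_up C \<beta> w \<alpha> = swap_on (kempe_path F C {Some \<alpha>, Some \<beta>} w) \<alpha> \<beta> (C(r \<mapsto> \<beta>))"

text \<open>The result of a deletion that picks the child \<open>w\<close>. The path is taken in
  \<open>D\<close>, which still has the color of the deleted edge; by \<open>kempe_path_G\<close>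
  that entry has no influence.\<close>

definition swap_down :: "'v coloring \<Rightarrow> 'v \<Rightarrow> 'v coloring" where
  "swap_down D w = swap_on (kempe_path F D {D r, D w} w) (the (D r)) (the (D w)) (D(r := None))"

section \<open>Insertions into a proper coloring of \<open>F\<close>\<close>

context
  fixes C
  assumes C: "C \<in> proper_colorings \<kappa> F"
begin

lemma C_dom: "dom C = dom F" and C_ran: "ran C \<subseteq> {1..\<kappa>}" and C_proper: "proper_on F (dom F) C"
  using C by (auto simp: proper_colorings_def)

lemma C_r: "C r = None"
  using C_dom root by (metis domIff)

lemma C_inj: "F w = Some r \<Longrightarrow> F w' = Some r \<Longrightarrow> C w = C w' \<Longrightarrow> w = w'"
  by (rule proper_onD[OF C_proper]) auto

lemma avail_p_D:
  assumes "\<beta> \<in> avail \<kappa> F C p"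
  shows "\<beta> \<in> {1..\<kappa>}" "C p \<noteq> Some \<beta>" "F y = Some p \<Longrightarrow> C y \<noteq> Some \<beta>"
  using assms by (auto simp: avail_def)

lemma dom_ran_upd: "\<beta> \<in> {1..\<kappa>} \<Longrightarrow> dom (C(r \<mapsto> \<beta>)) = dom G \<and> ran (C(r \<mapsto> \<beta>)) \<subseteq> {1..\<kappa>}"
  using C_dom C_ran C_r by auto

text \<open>As \<beta> is free at \<open>p\<close>, the new edge has no conflict at its upper end;
  the only possible one is with a child edge of \<open>r\<close> colored \<beta>. This is the
  exception that \<open>proper_on_swap_on\<close> tolerates.\<close>

lemma upd_conflict:
  assumes "\<beta> \<in> avail \<kappa> F C p" "x \<in> dom G" "y \<in> dom G" "G x = G y \<or> G x = Some y"
    "(C(r \<mapsto> \<beta>)) x = (C(r \<mapsto> \<beta>)) y"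
  shows "x = y \<or> (F x = Some r \<and> C x = Some \<beta> \<and> y = r)"
proof (cases "x = r"; cases "y = r")
  assume "x = r" "y \<noteq> r"
  then show ?thesis using assms avail_p_D(2)[OF assms(1)] avail_p_D(3)[OF assms(1), of y] by auto
next
  assume "x \<noteq> r" "y = r"
  then show ?thesis using assms avail_p_D(3)[OF assms(1), of x] by auto
next
  assume "x \<noteq> r" "y \<noteq> r"
  then show ?thesis using assms(2-) dom_G by (auto intro: proper_onD[OF C_proper])
qed auto

lemma upd_proper:
  assumes "\<beta> \<in> avail \<kappa> F C p" "\<not> (\<exists>w. F w = Some r \<and> C w = Some \<beta>)"
  shows "C(r \<mapsto> \<beta>) \<in> proper_colorings \<kappa> G"
  using dom_ran_upd[OF avail_p_D(1)[OF assms(1)]] upd_conflict[OF assms(1)] assms(2)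
  unfolding proper_colorings_def proper_on_def by blast

lemma avail_r_D:
  assumes "\<alpha> \<in> avail \<kappa> F C r"
  shows "\<alpha> \<in> {1..\<kappa>}" "F y = Some r \<Longrightarrow> C y \<noteq> Some \<alpha>"
  using assms by (auto simp: avail_def)

lemma swap_up_proper:
  assumes "\<beta> \<in> avail \<kappa> F C p" "F w = Some r" "C w = Some \<beta>" "\<alpha> \<in> avail \<kappa> F C r"
  shows "swap_up C \<beta> w \<alpha> \<in> proper_colorings \<kappa> G"
proof -
  let ?C = "C(r \<mapsto> \<beta>)"
  have wr: "w \<noteq> r" by (rule child_neq_r[OF assms(2)])
  have path: "kempe_path G ?C {Some \<alpha>, Some \<beta>} w = kempe_path F C {Some \<alpha>, Some \<beta>} w"
    by (rule kempe_path_G[OF assms(2)]) simp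
  have "\<alpha> \<noteq> \<beta>" using avail_r_D(2)[OF assms(4,2)] assms(3) by auto
  have "proper_on G (dom G) (swap_on (kempe_path G ?C {Some \<alpha>, Some \<beta>} w) \<alpha> \<beta> ?C)"
  proof (rule proper_on_swap_on[OF forest_G])
    show "G w = Some r" using assms(2) wr by simp
    show "?C w = Some \<beta>" using assms(3) wr by simp
    show "?C r \<noteq> Some \<alpha>" using \<open>\<alpha> \<noteq> \<beta>\<close> by simp
    show "?C x \<noteq> Some \<alpha>" if "G x = Some r" for x
      using that avail_r_D(2)[OF assms(4), of x] p_neq_r by (auto split: if_splits)
    show "x = y \<or> (x = w \<and> y = r)"
      if "x \<in> dom G" "y \<in> dom G" "G x = G y \<or> G x = Some y" "?C x = ?C y" for x y
      using upd_conflict[OF assms(1) that] C_inj[of x w] assms(2,3) by auto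
  qed fact
  moreover have "dom (swap_up C \<beta> w \<alpha>) = dom G"
    unfolding swap_up_def dom_swap_on using dom_ran_upd[OF avail_p_D(1)[OF assms(1)]] by simp
  moreover have "ran (swap_up C \<beta> w \<alpha>) \<subseteq> {1..\<kappa>}"
    unfolding swap_up_def
    using dom_ran_upd[OF avail_p_D(1)[OF assms(1)]] avail_p_D(1)[OF assms(1)] avail_r_D(1)[OF assms(4)]
    by (intro ran_swap_on) auto
  ultimately show ?thesis by (simp add: proper_colorings_def swap_up_def path)
qed

text \<open>The conflict at \<open>r\<close> does no harm: \<open>r\<close> is not among
  \<open>w\<close> and its descendants, and there the coloring is proper.\<close>

lemma fix_forbidden_swap_up:
  assumes "F w = Some r" "C w = Some \<beta>" "\<alpha> \<noteq> \<beta>"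
  shows "fix_forbidden G w \<beta> \<alpha> (C(r \<mapsto> \<beta>, w \<mapsto> \<alpha>)) = swap_up C \<beta> w \<alpha>"
proof -
  let ?C = "C(r \<mapsto> \<beta>)"
  have wr: "w \<noteq> r" by (rule child_neq_r[OF assms(1)])
  have path: "kempe_path G ?C {Some \<alpha>, Some \<beta>} w = kempe_path F C {Some \<alpha>, Some \<beta>} w"
    by (rule kempe_path_G[OF assms(1)]) simp
  have "proper_on G (insert w (below G w)) ?C"
    unfolding proper_on_def
  proof (intro ballI impI)
    fix x y assume xy: "x \<in> insert w (below G w)" "y \<in> insert w (below G w)"
      and adj: "G x = G y \<or> G x = Some y" and eq: "?C x = ?C y"
    have ne: "x \<noteq> r" "y \<noteq> r" using xy r_not_desc_G[OF assms(1)] by auto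
    moreover have "x \<in> dom G" "y \<in> dom G" using xy below_subset_dom[of G w] assms(1) by auto
    ultimately show "x = y" using adj eq by (auto intro: proper_onD[OF C_proper])
  qed
  then show ?thesis
    using fix_forbidden_eq_swap_on[OF forest_G, of ?C w \<beta> \<alpha>] assms wr
    by (simp add: swap_up_def path)
qed

text \<open>The algorithm evaluates \<open>avail\<close> after the new edge has got \<beta>, but
  \<beta> was already present at \<open>r\<close>, on the edge of \<open>w\<close>. Hence \<alpha>
  has as many choices as if the new edge were absent.\<close>

lemma avail_G_r: "F w = Some r \<Longrightarrow> C w = Some \<beta> \<Longrightarrow> avail \<kappa> G (C(r \<mapsto> \<beta>)) r = avail \<kappa> F C r"
  using C_r child_neq_r unfolding avail_def children_G_r by (auto split: if_splits)

lemma avail_p_nonempty: "avail \<kappa> F C p \<noteq> {}"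
  using card_avail[OF forest_F C, of p] degree_F_p_less by auto

lemma avail_r_nonempty: "avail \<kappa> F C r \<noteq> {}"
  using card_avail[OF forest_F C, of r] degree_F_r card_children_r_less by auto

lemma insert_step_eq:
  "insert_step \<kappa> F p r C =
     pmf_of_set (avail \<kappa> F C p) \<bind> (\<lambda>\<beta>.
       if \<exists>w. F w = Some r \<and> C w = Some \<beta>
       then map_pmf (swap_up C \<beta> (THE w. F w = Some r \<and> C w = Some \<beta>)) (pmf_of_set (avail \<kappa> F C r))
       else return_pmf (C(r \<mapsto> \<beta>)))"
  unfolding insert_step_def Let_def
proof (rule bind_pmf_cong[OF refl])
  fix \<beta>
  have iff: "w \<in> children G r \<and> (C(r \<mapsto> \<beta>)) w = Some \<beta> \<longleftrightarrow> F w = Some r \<and> C w = Some \<beta>" for w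
    using child_neq_r[of w] unfolding children_G_r by auto
  have ex: "(\<exists>w\<in>children G r. (C(r \<mapsto> \<beta>)) w = Some \<beta>) \<longleftrightarrow> (\<exists>w. F w = Some r \<and> C w = Some \<beta>)"
    using iff by blast
  show "(if \<exists>w\<in>children G r. (C(r \<mapsto> \<beta>)) w = Some \<beta>
       then pmf_of_set (avail \<kappa> G (C(r \<mapsto> \<beta>)) r) \<bind>
         (\<lambda>\<alpha>. return_pmf (fix_forbidden G (THE w. w \<in> children G r \<and> (C(r \<mapsto> \<beta>)) w = Some \<beta>) \<beta> \<alpha>
            (C(r \<mapsto> \<beta>, THE w. w \<in> children G r \<and> (C(r \<mapsto> \<beta>)) w = Some \<beta> \<mapsto> \<alpha>))))
       else return_pmf (C(r \<mapsto> \<beta>))) =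
     (if \<exists>w. F w = Some r \<and> C w = Some \<beta>
       then map_pmf (swap_up C \<beta> (THE w. F w = Some r \<and> C w = Some \<beta>)) (pmf_of_set (avail \<kappa> F C r))
       else return_pmf (C(r \<mapsto> \<beta>)))"
    unfolding ex iff
  proof (rule if_cong[OF refl _ refl])
    assume "\<exists>w. F w = Some r \<and> C w = Some \<beta>"
    then obtain w where w: "F w = Some r" "C w = Some \<beta>" by blast
    then have the: "(THE w. F w = Some r \<and> C w = Some \<beta>) = w"
      using C_inj by (intro the_equality) auto
    show "pmf_of_set (avail \<kappa> G (C(r \<mapsto> \<beta>)) r) \<bind>
         (\<lambda>\<alpha>. return_pmf (fix_forbidden G (THE w. F w = Some r \<and> C w = Some \<beta>) \<beta> \<alpha>
            (C(r \<mapsto> \<beta>, THE w. F w = Some r \<and> C w = Some \<beta> \<mapsto> \<alpha>)))) =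
      map_pmf (swap_up C \<beta> (THE w. F w = Some r \<and> C w = Some \<beta>)) (pmf_of_set (avail \<kappa> F C r))"
      unfolding the avail_G_r[OF w] map_pmf_def
    proof (rule bind_pmf_cong[OF refl])
      fix \<alpha> assume "\<alpha> \<in> set_pmf (pmf_of_set (avail \<kappa> F C r))"
      then have "\<alpha> \<in> avail \<kappa> F C r"
        by (simp add: set_pmf_of_set[OF avail_r_nonempty finite_avail])
      then have "\<alpha> \<noteq> \<beta>" using avail_r_D(2)[of \<alpha> w] w by auto
      then show "return_pmf (fix_forbidden G w \<beta> \<alpha> (C(r \<mapsto> \<beta>, w \<mapsto> \<alpha>))) =
          return_pmf (swap_up C \<beta> w \<alpha>)"
        using fix_forbidden_swap_up[OF w] by simp
    qed
  qed
qed

lemma set_pmf_insert_step: "set_pmf (insert_step \<kappa> F p r C) \<subseteq> proper_colorings \<kappa> G"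
proof
  fix D assume "D \<in> set_pmf (insert_step \<kappa> F p r C)"
  then obtain \<beta> where \<beta>: "\<beta> \<in> avail \<kappa> F C p" and D:
    "D \<in> set_pmf (if \<exists>w. F w = Some r \<and> C w = Some \<beta>
       then map_pmf (swap_up C \<beta> (THE w. F w = Some r \<and> C w = Some \<beta>)) (pmf_of_set (avail \<kappa> F C r))
       else return_pmf (C(r \<mapsto> \<beta>)))"
    unfolding insert_step_eq set_bind_pmf set_pmf_of_set[OF avail_p_nonempty finite_avail] by blast
  show "D \<in> proper_colorings \<kappa> G"
  proof (cases "\<exists>w. F w = Some r \<and> C w = Some \<beta>")
    case True
    then obtain w where w: "F w = Some r" "C w = Some \<beta>" by blast
    then have the: "(THE w. F w = Some r \<and> C w = Some \<beta>) = w"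
      using C_inj by (intro the_equality) auto
    show ?thesis
      using True D swap_up_proper[OF \<beta> w]
      by (auto simp: the set_pmf_of_set[OF avail_r_nonempty finite_avail])
  next
    case False
    then have "D = C(r \<mapsto> \<beta>)" using D by (simp only: if_False set_return_pmf singleton_iff)
    then show ?thesis using upd_proper[OF \<beta> False] by (simp only:)
  qed
qed

end

section \<open>Deletions from a proper coloring of \<open>G\<close>\<close>

context
  fixes D \<gamma>
  assumes D: "D \<in> proper_colorings \<kappa> G" and Dr: "D r = Some \<gamma>"
begin

lemma D_dom: "dom D = insert r (dom F)" and D_ran: "ran D \<subseteq> {1..\<kappa>}"
  and D_proper: "proper_on G (insert r (dom F)) D"
  using D dom_G by (auto simp: proper_colorings_def)

lemma D_child:
  assumes "F w = Some r"
  obtains \<delta> where "D w = Some \<delta>" "\<delta> \<noteq> \<gamma>" "\<delta> \<in> {1..\<kappa>}"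
proof -
  have w: "w \<in> dom F" using assms by auto
  then obtain \<delta> where \<delta>: "D w = Some \<delta>" using D_dom by blast
  moreover have "\<delta> \<in> {1..\<kappa>}" using ranI[of D w \<delta>, OF \<delta>] D_ran by blast
  moreover have "\<delta> \<noteq> \<gamma>"
  proof
    assume "\<delta> = \<gamma>"
    then have "w = r"
      using w \<delta> Dr assms child_neq_r[OF assms] by (intro proper_onD[OF D_proper]) auto
    then show False using child_neq_r[OF assms] by simp
  qed
  ultimately show ?thesis using that by blast
qed

lemma gamma_in_palette: "\<gamma> \<in> {1..\<kappa>}"
  using ranI[of D r \<gamma>, OF Dr] D_ran by blast

lemma D_inj: "F w = Some r \<Longrightarrow> F w' = Some r \<Longrightarrow> D w = D w' \<Longrightarrow> w = w'"
  using child_neq_r[of w] child_neq_r[of w'] by (intro proper_onD[OF D_proper]) auto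

lemma D_p_neq: "D p \<noteq> Some \<gamma>"
proof
  assume *: "D p = Some \<gamma>"
  then have "p \<in> insert r (dom F)" using D_dom by blast
  then have "r = p" using * Dr by (intro proper_onD[OF D_proper]) auto
  then show False using p_neq_r by simp
qed

lemma D_p_child_neq: "F y = Some p \<Longrightarrow> D y \<noteq> Some \<gamma>"
proof
  assume *: "F y = Some p" "D y = Some \<gamma>"
  then have "y \<noteq> r" using root by auto
  moreover have "y = r" using * Dr \<open>y \<noteq> r\<close> by (intro proper_onD[OF D_proper]) auto
  ultimately show False by simp
qed

lemma gamma_avail_p:
  assumes "C p = D p" "\<And>y. F y = Some p \<Longrightarrow> C y = D y"
  shows "\<gamma> \<in> avail \<kappa> F C p"
  using gamma_in_palette D_p_neq D_p_child_neq assms by (auto simp: avail_def)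

lemma del_dom_ran: "dom (D(r := None)) = dom F \<and> ran (D(r := None)) \<subseteq> {1..\<kappa>}"
proof -
  have "dom (D(r := None)) = dom F" using D_dom root by auto
  moreover have "ran (D(r := None)) \<subseteq> ran D" by (auto simp: ran_def)
  ultimately show ?thesis using D_ran by blast
qed

lemma del_proper_on: "proper_on F (dom F) (D(r := None))"
  unfolding proper_on_def
proof (intro ballI impI)
  fix x y assume xy: "x \<in> dom F" "y \<in> dom F" and adj: "F x = F y \<or> F x = Some y"
    and eq: "(D(r := None)) x = (D(r := None)) y"
  have "x \<noteq> r" "y \<noteq> r" using xy root by auto
  then show "x = y" using xy adj eq by (intro proper_onD[OF D_proper]) auto
qed

lemma del_proper: "D(r := None) \<in> proper_colorings \<kappa> F"
  using del_dom_ran del_proper_on by (simp add: proper_colorings_def)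

lemma swap_down_eq:
  assumes "F w = Some r" "D w = Some \<delta>"
  shows "swap_down D w = swap_on (kempe_path F (D(r := None)) {Some \<gamma>, Some \<delta>} w) \<gamma> \<delta> (D(r := None))"
  using kempe_path_G(2)[OF assms(1), of "D(r := None)" "{Some \<gamma>, Some \<delta>}" D] assms(2) Dr
  by (simp add: swap_down_def)

lemma swap_down_proper:
  assumes "F w = Some r"
  shows "swap_down D w \<in> proper_colorings \<kappa> F"
proof -
  obtain \<delta> where \<delta>: "D w = Some \<delta>" "\<delta> \<noteq> \<gamma>" "\<delta> \<in> {1..\<kappa>}" by (rule D_child[OF assms])
  let ?D = "D(r := None)"
  have "proper_on F (dom F) (swap_on (kempe_path F ?D {Some \<gamma>, Some \<delta>} w) \<gamma> \<delta> ?D)"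
  proof (rule proper_on_swap_on[OF forest_F assms])
    show "?D w = Some \<delta>" using \<delta>(1) child_neq_r[OF assms] by simp
    show "?D x \<noteq> Some \<gamma>" if "F x = Some r" for x
      using D_child[OF that] child_neq_r[OF that] by (metis fun_upd_other option.inject)
    show "x = y \<or> (x = w \<and> y = r)"
      if "x \<in> dom F" "y \<in> dom F" "F x = F y \<or> F x = Some y" "?D x = ?D y" for x y
      using proper_onD[OF del_proper_on that] by simp
  qed (use \<delta>(2) in auto)
  moreover have "ran (swap_down D w) \<subseteq> {1..\<kappa>}"
    unfolding swap_down_eq[OF assms \<delta>(1)] using del_dom_ran gamma_in_palette \<delta>(3) by (intro ran_swap_on) auto
  moreover have "dom (swap_down D w) = dom F"
    unfolding swap_down_eq[OF assms \<delta>(1)] dom_swap_on using del_dom_ran by simp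
  ultimately show ?thesis by (simp add: proper_colorings_def swap_down_eq[OF assms \<delta>(1)])
qed

text \<open>Hence the child that a deletion picked can be read off its result: it is the one that
  carries the color of the deleted edge.\<close>

lemma swap_down_w:
  assumes "F w = Some r"
  shows "swap_down D w w = Some \<gamma>"
proof -
  obtain \<delta> where \<delta>: "D w = Some \<delta>" by (rule D_child[OF assms])
  then show ?thesis
    using child_neq_r[OF assms] unfolding swap_down_eq[OF assms \<delta>]
    by (simp add: swap_on_def kempe_path_base)
qed

lemma fix_forbidden_swap_down:
  assumes "F w = Some r"
  shows "fix_forbidden F w (the (D w)) \<gamma> (D(r := None, w \<mapsto> \<gamma>)) = swap_down D w"
proof -
  obtain \<delta> where \<delta>: "D w = Some \<delta>" "\<delta> \<noteq> \<gamma>" by (rule D_child[OF assms])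
  have "proper_on F (insert w (below F w)) (D(r := None))"
    using below_subset_dom[of F w] assms by (intro proper_on_subset[OF del_proper_on]) auto
  then show ?thesis
    using fix_forbidden_eq_swap_on[OF forest_F, of "D(r := None)" w \<delta> \<gamma>] \<delta> child_neq_r[OF assms]
    by (simp add: swap_down_eq[OF assms \<delta>(1)])
qed

text \<open>With l children of \<open>r\<close>, each of them is picked with probability
  (l/\<kappa>)(1/l) = 1/\<kappa>, so it only matters how many of them lead to
  \<open>C\<close>.\<close>

lemma pmf_delete_step:
  "pmf (delete_step \<kappa> G r D) C =
     ((real \<kappa> - card (children F r)) * of_bool (D(r := None) = C)
       + card {w. F w = Some r \<and> swap_down D w = C}) / \<kappa>"
proof -
  let ?l = "card (children F r)"
  let ?W = "{w. F w = Some r \<and> swap_down D w = C}"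
  let ?X = "pmf_of_set (children F r) \<bind>
      (\<lambda>w. return_pmf (fix_forbidden F w (the ((D(r := None)) w)) \<gamma> (D(r := None, w \<mapsto> \<gamma>))))"
  have \<kappa>: "?l < \<kappa>" by (rule card_children_r_less)
  have q: "0 \<le> (real \<kappa> - ?l) / \<kappa>" "(real \<kappa> - ?l) / \<kappa> \<le> 1"
    using \<kappa> by (auto simp: field_simps)
  have Fr: "G(r := None) = F" using root by (auto simp: fun_eq_iff)
  have "delete_step \<kappa> G r D = bernoulli_pmf ((real \<kappa> - ?l) / \<kappa>) \<bind>
      (\<lambda>stop. if stop then return_pmf (D(r := None)) else ?X)"
    unfolding delete_step_def Let_def Fr Dr option.sel ..
  then have "pmf (delete_step \<kappa> G r D) C =
      pmf (return_pmf (D(r := None))) C * ((real \<kappa> - ?l) / \<kappa>)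
        + pmf ?X C * (1 - (real \<kappa> - ?l) / \<kappa>)"
    by (simp only: pmf_bind integral_bernoulli_pmf[OF q] if_True if_False)
  also have "pmf (return_pmf (D(r := None))) C = of_bool (D(r := None) = C)"
    by simp
  \<comment> \<open>Without children \<open>pmf_of_set\<close> is applied to the empty set, but then
    the deletion stops with probability 1 and this term has weight 0.\<close>
  also have "pmf ?X C * (1 - (real \<kappa> - ?l) / \<kappa>) = card ?W / \<kappa>"
  proof (cases "children F r = {}")
    case True
    then show ?thesis using \<kappa> by (simp add: children_def)
  next
    case False
    have "pmf ?X C = (\<Sum>w\<in>children F r. of_bool (swap_down D w = C)) / ?l"
      unfolding pmf_bind_pmf_of_set[OF False finite]
    proof (intro arg_cong2[where f = divide] sum.cong refl)
      fix w assume "w \<in> children F r"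
      then have w: "F w = Some r" by simp
      then show "pmf (return_pmf (fix_forbidden F w (the ((D(r := None)) w)) \<gamma> (D(r := None, w \<mapsto> \<gamma>)))) C
          = of_bool (swap_down D w = C)"
        using fix_forbidden_swap_down[OF w] child_neq_r[OF w] by simp
    qed
    also have "(\<Sum>w\<in>children F r. of_bool (swap_down D w = C)) = real (card ?W)"
    proof -
      have "children F r \<inter> {w. swap_down D w = C} = ?W" by auto
      then show ?thesis by (simp add: of_bool_def sum.If_cases)
    qed
    finally have "pmf ?X C = card ?W / ?l" .
    moreover have "?l > 0" using False by (simp add: card_gt_0_iff)
    moreover have "1 - (real \<kappa> - ?l) / \<kappa> = ?l / \<kappa>" using \<kappa> by (simp add: field_simps)
    moreover have "x / y * (y / \<kappa>) = x / \<kappa>" if "y > 0" for x y :: real using that by simp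
    then have "card ?W / ?l * (?l / \<kappa>) = card ?W / \<kappa>" by this (simp only: \<open>?l > 0\<close> of_nat_0_less_iff)
    ultimately show ?thesis by (simp only:)
  qed
  finally show ?thesis
    by (simp only: add_divide_distrib times_divide_eq_right mult.commute[of "real \<kappa> - ?l"])
qed

lemma set_pmf_delete_step: "set_pmf (delete_step \<kappa> G r D) \<subseteq> proper_colorings \<kappa> F"
proof
  fix C assume "C \<in> set_pmf (delete_step \<kappa> G r D)"
  then have "pmf (delete_step \<kappa> G r D) C \<noteq> 0" by (simp add: set_pmf_iff)
  then have "D(r := None) = C \<or> card {w. F w = Some r \<and> swap_down D w = C} \<noteq> 0"
    unfolding pmf_delete_step by (cases "D(r := None) = C") simp_all
  then have "D(r := None) = C \<or> {w. F w = Some r \<and> swap_down D w = C} \<noteq> {}"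
    by (metis card.empty)
  then show "C \<in> proper_colorings \<kappa> F" using del_proper swap_down_proper by auto
qed

text \<open>An exchange never moves a color into or out of the pair \<gamma>, \<delta>, so
  \<open>C\<close> and \<open>D\<close> have the same path from \<open>w\<close>, and exchanging
  twice along it restores the coloring. From right to left the availability must also be recovered:
  \<gamma> is free at \<open>p\<close> because the edges there are untouched, and \<delta> is free
  at \<open>r\<close> because \<open>D\<close> has it there only on \<open>w\<close>.\<close>

lemma swap_up_swap_down_iff:
  assumes C: "C \<in> proper_colorings \<kappa> F" and w: "F w = Some r" "C w = Some \<gamma>" and \<delta>: "D w = Some \<delta>" "\<delta> \<noteq> \<gamma>"
  shows "(\<gamma> \<in> avail \<kappa> F C p \<and> \<delta> \<in> avail \<kappa> F C r \<and> swap_up C \<gamma> w \<delta> = D) \<longleftrightarrow> swap_down D w = C"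
proof
  let ?A = "{Some \<delta>, Some \<gamma>}" and ?P = "kempe_path F C {Some \<delta>, Some \<gamma>} w"
  assume "\<gamma> \<in> avail \<kappa> F C p \<and> \<delta> \<in> avail \<kappa> F C r \<and> swap_up C \<gamma> w \<delta> = D"
  then have D_eq: "D = swap_on ?P \<delta> \<gamma> (C(r \<mapsto> \<gamma>))" by (simp add: swap_up_def)
  have "D x \<in> ?A \<longleftrightarrow> C x \<in> ?A" if "x \<noteq> r" for x
    using swap_on_eq_Some_iff[OF \<delta>(2), of ?P "C(r \<mapsto> \<gamma>)" x] that unfolding D_eq by simp
  then have "kempe_path F D ?A w = ?P" by (rule kempe_path_G(2)[OF w(1)])
  moreover have "{D r, D w} = ?A" using Dr \<delta>(1) by auto
  ultimately have "swap_down D w = swap_on ?P \<gamma> \<delta> (D(r := None))"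
    using Dr \<delta>(1) by (simp add: swap_down_def)
  also have "\<dots> = (swap_on ?P \<delta> \<gamma> D)(r := None)"
    unfolding swap_on_commute[of _ \<gamma> \<delta>] using r_not_kempe[OF w(1)] by (auto simp: swap_on_def fun_eq_iff)
  also have "\<dots> = C"
    unfolding D_eq swap_on_involutory using C_r[OF C] by (auto simp: fun_eq_iff)
  finally show "swap_down D w = C" .
next
  let ?A = "{Some \<gamma>, Some \<delta>}" and ?P = "kempe_path F D {Some \<gamma>, Some \<delta>} w"
  assume "swap_down D w = C"
  then have C_eq: "C = swap_on ?P \<gamma> \<delta> (D(r := None))"
    using Dr \<delta>(1) by (simp add: swap_down_def)
  have C_out: "C x = D x" if "x \<notin> ?P" "x \<noteq> r" for x
    using that unfolding C_eq swap_on_def by simp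
  have p: "\<gamma> \<in> avail \<kappa> F C p"
  proof (rule gamma_avail_p)
    show "C p = D p" by (rule C_out[OF p_not_kempe[OF w(1)] p_neq_r])
    show "C y = D y" if "F y = Some p" for y
      using that root by (intro C_out[OF p_child_not_kempe[OF w(1) that]]) auto
  qed
  moreover have "\<delta> \<in> avail \<kappa> F C r"
  proof -
    have "C x \<noteq> Some \<delta>" if x: "F x = Some r" for x
    proof (cases "x = w")
      case True
      then show ?thesis using w(2) \<delta>(2) by simp
    next
      case False
      then have "C x = D x"
        by (rule C_out[OF sibling_not_kempe[OF w(1) x] child_neq_r[OF x]])
      then show ?thesis using D_inj[OF x w(1)] \<delta>(1) False by auto
    qed
    moreover have "\<delta> \<in> {1..\<kappa>}" using ranI[of D w \<delta>, OF \<delta>(1)] D_ran by blast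
    ultimately show ?thesis using C_r[OF C] by (auto simp: avail_def)
  qed
  moreover have "swap_up C \<gamma> w \<delta> = D"
  proof -
    have "C x \<in> ?A \<longleftrightarrow> D x \<in> ?A" if "x \<noteq> r" for x
      using swap_on_eq_Some_iff[of \<gamma> \<delta> ?P "D(r := None)" x] that \<delta>(2) unfolding C_eq by simp
    then have "kempe_path F C ?A w = ?P" by (rule kempe_path_G(2)[OF w(1)])
    moreover have "{Some \<delta>, Some \<gamma>} = ?A" by auto
    ultimately have "swap_up C \<gamma> w \<delta> = swap_on ?P \<gamma> \<delta> (C(r \<mapsto> \<gamma>))"
      unfolding swap_up_def swap_on_commute[of _ \<delta> \<gamma>] by simp
    also have "\<dots> = (swap_on ?P \<gamma> \<delta> C)(r \<mapsto> \<gamma>)"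
      using r_not_kempe[OF w(1)] by (auto simp: swap_on_def fun_eq_iff)
    also have "\<dots> = D"
      unfolding C_eq swap_on_involutory using Dr by (auto simp: fun_eq_iff)
    finally show ?thesis .
  qed
  ultimately show "\<gamma> \<in> avail \<kappa> F C p \<and> \<delta> \<in> avail \<kappa> F C r \<and> swap_up C \<gamma> w \<delta> = D" by blast
qed

text \<open>If a child edge of \<open>r\<close> has color \<gamma> in \<open>C\<close>, a deletion
  arriving at \<open>C\<close> must have recolored that edge; if none has, it must have stopped. So
  at most one of the two terms of \<open>pmf_delete_step\<close> is nonzero.\<close>

lemma reversal:
  assumes C: "C \<in> proper_colorings \<kappa> F"
  shows "pmf (insert_step \<kappa> F p r C) D =
     real \<kappa> / ((real \<kappa> - degree F p) * (real \<kappa> - card (children F r))) * pmf (delete_step \<kappa> G r D) C"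
proof -
  let ?l = "card (children F r)"
  let ?W = "{w. F w = Some r \<and> swap_down D w = C}"
  define K where "K \<beta> = (if \<exists>w. F w = Some r \<and> C w = Some \<beta>
       then map_pmf (swap_up C \<beta> (THE w. F w = Some r \<and> C w = Some \<beta>)) (pmf_of_set (avail \<kappa> F C r))
       else return_pmf (C(r \<mapsto> \<beta>)))" for \<beta>
  have the: "(THE w. F w = Some r \<and> C w = Some \<beta>) = w" if "F w = Some r" "C w = Some \<beta>" for w \<beta>
    using that C_inj[OF C] by (intro the_equality) auto
  have l: "?l < \<kappa>" by (rule card_children_r_less)
  have card_r: "card (avail \<kappa> F C r) = \<kappa> - ?l"
    using card_avail[OF forest_F C, of r] degree_F_r by simp
  have card_p: "card (avail \<kappa> F C p) = \<kappa> - degree F p" by (rule card_avail[OF forest_F C])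
  \<comment> \<open>The edge above \<open>r\<close> keeps the color \<beta> it is given, since
    \<open>r\<close> is not on the path, so only the choice \<beta> = \<gamma> can lead to
    \<open>D\<close>.\<close>
  have K_other: "pmf (K \<beta>) D = 0" if "\<beta> \<noteq> \<gamma>" for \<beta>
  proof -
    have color: "E r = Some \<beta>" if E: "E \<in> set_pmf (K \<beta>)" for E
    proof (cases "\<exists>w. F w = Some r \<and> C w = Some \<beta>")
      case True
      then obtain w where w: "F w = Some r" "C w = Some \<beta>" by blast
      then obtain \<alpha> where "E = swap_up C \<beta> w \<alpha>"
        using E True by (auto simp: K_def the[OF w])
      then show ?thesis using r_not_kempe[OF w(1)] by (simp add: swap_up_def swap_on_def)
    next
      case False
      then have "K \<beta> = return_pmf (C(r \<mapsto> \<beta>))" unfolding K_def by (rule if_not_P)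
      then show ?thesis using E by simp
    qed
    show ?thesis using color[of D] Dr that by (auto simp: pmf_eq_0_set_pmf)
  qed
  have core: "of_bool (\<gamma> \<in> avail \<kappa> F C p) * pmf (K \<gamma>) D * (real \<kappa> - ?l) =
      (real \<kappa> - ?l) * of_bool (D(r := None) = C) + card ?W"
  proof (cases "\<exists>w. F w = Some r \<and> C w = Some \<gamma>")
    case True
    then obtain w where w: "F w = Some r" "C w = Some \<gamma>" by blast
    obtain \<delta> where \<delta>: "D w = Some \<delta>" "\<delta> \<noteq> \<gamma>" by (rule D_child[OF w(1)])
    have ne: "D(r := None) \<noteq> C" using \<delta> w child_neq_r[OF w(1)] by auto
    have "?W \<subseteq> {w}"
      using swap_down_w C_inj[OF C _ w(1)] w(2) by force
    then have "?W = (if swap_down D w = C then {w} else {})" using w(1) by auto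
    then have W: "card ?W = of_bool (swap_down D w = C)" by simp
    \<comment> \<open>The edge of \<open>w\<close> ends up with color \<alpha>, so \<delta> is the
      only choice that can produce \<open>D\<close>.\<close>
    have "avail \<kappa> F C r \<inter> swap_up C \<gamma> w -` {D} =
        (if \<delta> \<in> avail \<kappa> F C r \<and> swap_up C \<gamma> w \<delta> = D then {\<delta>} else {})"
    proof -
      have "\<alpha> = \<delta>" if "swap_up C \<gamma> w \<alpha> = D" for \<alpha>
      proof -
        have "swap_up C \<gamma> w \<alpha> w = Some \<alpha>"
          using w child_neq_r[OF w(1)] by (simp add: swap_up_def swap_on_def kempe_path_base)
        then show ?thesis using that \<delta>(1) by simp
      qed
      then show ?thesis by auto
    qed
    then have "pmf (K \<gamma>) D = of_bool (\<delta> \<in> avail \<kappa> F C r \<and> swap_up C \<gamma> w \<delta> = D) / (real \<kappa> - ?l)"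
      using True l card_r
      by (simp add: K_def the[OF w] pmf_map measure_pmf_of_set[OF avail_r_nonempty[OF C] finite_avail]
          of_nat_diff)
    then have "of_bool (\<gamma> \<in> avail \<kappa> F C p) * pmf (K \<gamma>) D * (real \<kappa> - ?l) =
        of_bool (\<gamma> \<in> avail \<kappa> F C p \<and> \<delta> \<in> avail \<kappa> F C r \<and> swap_up C \<gamma> w \<delta> = D)"
      using l by simp
    also have "\<dots> = of_bool (swap_down D w = C)"
      unfolding swap_up_swap_down_iff[OF C w \<delta>] ..
    finally show ?thesis using ne W by simp
  next
    case False
    then have "K \<gamma> = return_pmf (C(r \<mapsto> \<gamma>))" unfolding K_def by (rule if_not_P)
    moreover have "?W = {}" using False swap_down_w by auto
    moreover have "\<gamma> \<in> avail \<kappa> F C p \<and> C(r \<mapsto> \<gamma>) = D \<longleftrightarrow> D(r := None) = C"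
    proof
      assume "\<gamma> \<in> avail \<kappa> F C p \<and> C(r \<mapsto> \<gamma>) = D"
      then have "D = C(r \<mapsto> \<gamma>)" by simp
      then show "D(r := None) = C" using C_r[OF C] by (auto simp: fun_eq_iff)
    next
      assume eq: "D(r := None) = C"
      have "\<gamma> \<in> avail \<kappa> F C p"
        using eq p_neq_r root by (intro gamma_avail_p) auto
      moreover have "C(r \<mapsto> \<gamma>) = D" unfolding eq[symmetric] using Dr by (auto simp: fun_eq_iff)
      ultimately show "\<gamma> \<in> avail \<kappa> F C p \<and> C(r \<mapsto> \<gamma>) = D" ..
    qed
    ultimately show ?thesis by (auto simp: indicator_def)
  qed
  have "pmf (insert_step \<kappa> F p r C) D = (\<Sum>\<beta>\<in>avail \<kappa> F C p. pmf (K \<beta>) D) / (\<kappa> - degree F p)"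
    unfolding insert_step_eq[OF C] K_def[symmetric] card_p[symmetric]
    by (rule pmf_bind_pmf_of_set[OF avail_p_nonempty[OF C] finite_avail])
  also have "(\<Sum>\<beta>\<in>avail \<kappa> F C p. pmf (K \<beta>) D) =
      (\<Sum>\<beta>\<in>avail \<kappa> F C p. if \<gamma> = \<beta> then pmf (K \<gamma>) D else 0)"
    using K_other by (intro sum.cong) auto
  also have "\<dots> = of_bool (\<gamma> \<in> avail \<kappa> F C p) * pmf (K \<gamma>) D"
    by (simp add: sum.delta'[OF finite_avail] sum.delta[OF finite_avail])
  also have "\<dots> = ((real \<kappa> - ?l) * of_bool (D(r := None) = C) + card ?W) / (real \<kappa> - ?l)"
    using core l by (simp add: eq_divide_eq)
  finally show ?thesis
    unfolding pmf_delete_step using l degree_F_p_less by (simp add: of_nat_diff)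
qed

end

lemma D_r_Some:
  assumes "D \<in> proper_colorings \<kappa> G"
  obtains \<gamma> where "D r = Some \<gamma>"
proof -
  have "r \<in> dom D" using assms by (simp add: proper_colorings_def)
  then show ?thesis using that by blast
qed

lemma bind_insert_step:
  assumes "proper_colorings \<kappa> F \<noteq> {}"
  shows "pmf_of_set (proper_colorings \<kappa> F) \<bind> insert_step \<kappa> F p r = pmf_of_set (proper_colorings \<kappa> G)"
  using finite_proper_colorings finite_proper_colorings assms set_pmf_insert_step
proof (rule bind_uniform_of_reversal)
  fix D assume D: "D \<in> proper_colorings \<kappa> G"
  then obtain \<gamma> where "D r = Some \<gamma>" by (rule D_r_Some)
  with D show "set_pmf (delete_step \<kappa> G r D) \<subseteq> proper_colorings \<kappa> F" by (rule set_pmf_delete_step)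
next
  fix C D assume C: "C \<in> proper_colorings \<kappa> F" and D: "D \<in> proper_colorings \<kappa> G"
  from D obtain \<gamma> where "D r = Some \<gamma>" by (rule D_r_Some)
  from reversal[OF D this C] show "pmf (insert_step \<kappa> F p r C) D =
     real \<kappa> / ((real \<kappa> - degree F p) * (real \<kappa> - card (children F r))) * pmf (delete_step \<kappa> G r D) C" .
qed

lemma bind_delete_step:
  assumes "proper_colorings \<kappa> G \<noteq> {}"
  shows "pmf_of_set (proper_colorings \<kappa> G) \<bind> delete_step \<kappa> G r = pmf_of_set (proper_colorings \<kappa> F)"
  using finite_proper_colorings finite_proper_colorings assms _ set_pmf_insert_step
proof (rule bind_uniform_of_reversal)
  fix D assume D: "D \<in> proper_colorings \<kappa> G"
  then obtain \<gamma> where "D r = Some \<gamma>" by (rule D_r_Some)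
  with D show "set_pmf (delete_step \<kappa> G r D) \<subseteq> proper_colorings \<kappa> F" by (rule set_pmf_delete_step)
next
  fix C D assume C: "C \<in> proper_colorings \<kappa> F" and D: "D \<in> proper_colorings \<kappa> G"
  from D obtain \<gamma> where "D r = Some \<gamma>" by (rule D_r_Some)
  \<comment> \<open>The reciprocal of the constant for insertions; all its factors are
    positive.\<close>
  from reversal[OF D this C] show "pmf (delete_step \<kappa> G r D) C =
     (real \<kappa> - degree F p) * (real \<kappa> - card (children F r)) / real \<kappa> * pmf (insert_step \<kappa> F p r C) D"
    using degree_F_p_less card_children_r_less by simp
qed

end

section \<open>The invariant along the update sequence\<close>

lemma legal_update_invariant:
  fixes F :: "'v::finite forest"
  assumes "is_forest F" "\<And>v. degree F v \<le> \<Delta>" "legal \<Delta> F u"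
  shows "is_forest (apply_update u F)" "degree (apply_update u F) v \<le> \<Delta>"
proof -
  show "is_forest (apply_update u F)"
  proof (cases u)
    case (Delete p r)
    have "edges (F(r := None)) \<subseteq> edges F" by (auto split: if_splits)
    then show ?thesis using assms(1) Delete acyclic_subset by (auto simp: is_forest_def)
  qed (use assms in auto)
  show "degree (apply_update u F) v \<le> \<Delta>"
  proof (cases u)
    case (Delete p r)
    have "children (F(r := None)) v \<subseteq> children F v" by (auto split: if_splits)
    then have "card (children (F(r := None)) v) \<le> card (children F v)" by (intro card_mono) auto
    then have "degree (F(r := None)) v \<le> degree F v" by (auto simp: degree_def)
    then show ?thesis using assms(2)[of v] Delete by simp
  qed (use assms in auto)
qed

lemma bind_dist_maint_step:
  fixes F :: "'v::finite forest"
  assumes "is_forest F" "\<And>v. degree F v \<le> \<Delta>" "legal \<Delta> F u" "\<Delta> \<le> \<kappa>"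
  shows "pmf_of_set (proper_colorings \<kappa> F) \<bind> dist_maint_step \<kappa> F u =
    pmf_of_set (proper_colorings \<kappa> (apply_update u F))"
proof -
  note inv = legal_update_invariant[OF assms(1-3)]
  have ne: "proper_colorings \<kappa> F \<noteq> {}"
    using assms(2,4) by (intro proper_colorings_nonempty[OF assms(1)]) (meson order_trans)
  show ?thesis
  proof (cases u)
    case (Insert p r)
    have "is_forest (F(r \<mapsto> p))" "degree (F(r \<mapsto> p)) v \<le> \<kappa>" for v
      using inv(1) inv(2)[of v] assms(4) Insert by simp_all
    moreover have "F r = None" using assms(3) Insert by simp
    ultimately interpret forest_link \<kappa> F p r by unfold_locales
    have "dist_maint_step \<kappa> F u = insert_step \<kappa> F p r" using Insert by (simp add: fun_eq_iff)
    then show ?thesis using bind_insert_step[OF ne] Insert by simp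
  next
    case (Delete p r)
    then have F: "F(r \<mapsto> p) = F" using assms(3) by (auto simp: fun_eq_iff)
    \<comment> \<open>With \<open>F(r := None)\<close> as the smaller forest, the larger forest of
      the locale is \<open>F\<close> itself.\<close>
    interpret forest_link \<kappa> "F(r := None)" p r
      by unfold_locales (use assms in \<open>auto simp: F intro: order_trans\<close>)
    have "dist_maint_step \<kappa> F u = delete_step \<kappa> F r" using Delete by (simp add: fun_eq_iff)
    then show ?thesis using bind_delete_step ne Delete by (simp add: F)
  qed
qed

theorem theorem4p3:
  fixes \<kappa> \<Delta> t :: nat
    and us :: "nat \<Rightarrow> 'v::finite update"
  assumes "\<Delta> \<ge> 2" and "\<kappa> \<ge> \<Delta>"
    and "\<And>s. s < t \<Longrightarrow> legal \<Delta> (forest_at us s) (us s)"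
  shows "coloring_at \<kappa> us t = dist_forest \<kappa> (forest_at us t)"
proof -
  \<comment> \<open>The induction runs on uniformity, which is what a single step transports.
    Acyclicity and the degree bound are carried along because a deletion is legal without mentioning
    them.\<close>
  have "is_forest (forest_at us t) \<and> (\<forall>v. degree (forest_at us t) v \<le> \<Delta>) \<and>
      coloring_at \<kappa> us t = pmf_of_set (proper_colorings \<kappa> (forest_at us t))"
    using assms(3)
  proof (induction t)
    case 0
    have "edges (\<lambda>_::'v. None) = {}" by auto
    moreover have "proper_colorings \<kappa> (\<lambda>_::'v. None) = {Map.empty}"
      by (auto simp: proper_colorings_def proper_on_def)
    moreover have "children (\<lambda>_::'v. None) v = {}" for v by auto
    ultimately show ?case
      by (simp add: is_forest_def acyclic_def degree_def pmf_of_set_singleton)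
  next
    case (Suc t)
    then have IH: "is_forest (forest_at us t)" "\<And>v. degree (forest_at us t) v \<le> \<Delta>"
      "coloring_at \<kappa> us t = pmf_of_set (proper_colorings \<kappa> (forest_at us t))"
      and legal: "legal \<Delta> (forest_at us t) (us t)"
      by auto
    show ?case
      using legal_update_invariant[OF IH(1,2) legal] bind_dist_maint_step[OF IH(1,2) legal assms(2)]
      by (simp add: IH(3))
  qed
  then show ?thesis using dist_forest_uniform assms(2) by (metis order_trans)
qed

end
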